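(* Let $H$ be a complex Hilbert space and let $S\in\mathbf{B}(\ell^{2}(\mathbb{Z},H))$ be a bilateral weighted shift with invertible weights $(S_{i})_{i\in\mathbb{Z}}\subset\mathbf{B}(H)$. For $m\in\mathbb{Z}_{1}$ the following conditions are equivalent: (i) $S$ is $m$-isometric; (ii) there exists $p\in\mathbf{B}(H)_{m-1}[z]$ such that $p(0)=I$ and $$p(n)=\lvert S_{n}\cdots S_{1}\rvert^{2},\quad n\in\mathbb{Z}_{1},$$ $$p(-n)=\lvert S_{-n+1}^{*}\cdots S_{0}^{*}\rvert^{-2},\quad n\in\mathbb{Z}_{1}.$$ Moreover, if (ii) holds (with polynomial $p$), then $$\lVert S\rVert^{2}=\sup\left\{\frac{\langle p(n+1)h,h\rangle}{\langle p(n)h,h\rangle}: n\in\mathbb{Z},\ h\in H,\ h\neq 0\right\}.$$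
   Context: $\mathbb{Z}_{p}=\{n\in\mathbb{Z}: n\ge p\}$. $\mathbf{B}(H)$ is the algebra of bounded linear operators on a complex Hilbert space $H$; invertible means invertible in $\mathbf{B}(H)$; $\lvert T\rvert=(T^{*}T)^{1/2}$ and, for invertible $T$, $\lvert T\rvert^{-2}=(T^{*}T)^{-1}$. The product $S_{-n+1}^{*}\cdots S_{0}^{*}$ is $S_{-n+1}^{*}S_{-n+2}^{*}\cdots S_{-1}^{*}S_{0}^{*}$ (increasing indices), and $S_{n}\cdots S_{1}$ has decreasing indices. $\ell^{2}(\mathbb{Z},H)$ is the Hilbert space of square-summable two-sided sequences $(h_{i})_{i\in\mathbb{Z}}$ in $H$. For a uniformly bounded sequence $(S_{i})_{i\in\mathbb{Z}}\subset\mathbf{B}(H)$, the bilateral weighted shift $S$ with weights $(S_{i})_{i\in\mathbb{Z}}$ is the bounded operator on $\ell^{2}(\mathbb{Z},H)$ given by $S(h_{i})_{i\in\mathbb{Z}}=(S_{i}h_{i-1})_{i\in\mathbb{Z}}$. A bounded operator $T$ is $m$-isometric ($m\in\mathbb{Z}_{1}$) if $\sum_{k=0}^{m}\binom{m}{k}(-1)^{m-k}T^{*k}T^{k}=0$. $\mathbf{B}(H)_{n}[z]$ denotes the space of polynomials $p(z)=\sum_{j=0}^{n}A_{j}z^{j}$ with coefficients $A_{j}\in\mathbf{B}(H)$ (degree at most $n$), evaluated at scalars $z\in\mathbb{C}$. Suprema are taken in $[0,\infty]$. *)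

theory Defs
  imports "HOL-Analysis.Analysis"
begin

class complex_vector = real_vector +
  fixes scaleC :: "complex \<Rightarrow> 'a \<Rightarrow> 'a" (infixr "*\<^sub>C" 75)
  assumes scaleC_add_right: "c *\<^sub>C (x + y) = c *\<^sub>C x + c *\<^sub>C y"
    and scaleC_add_left: "(c + d) *\<^sub>C x = c *\<^sub>C x + d *\<^sub>C x"
    and scaleC_scaleC [simp]: "c *\<^sub>C d *\<^sub>C x = (c * d) *\<^sub>C x"
    and scaleC_one [simp]: "1 *\<^sub>C x = x"
    and scaleR_scaleC: "r *\<^sub>R x = complex_of_real r *\<^sub>C x"

text \<open>
  The inner product is linear in its first argument. The real inner product of the class
  real_inner, and hence the norm, is the one determined by cinner: since
  \<open>cinner x x\<close> is real, \<open>cinner x x = (norm x)\<^sup>2\<close>.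
\<close>
class complex_inner = complex_vector + real_inner +
  fixes cinner :: "'a \<Rightarrow> 'a \<Rightarrow> complex"
  assumes cinner_commute: "cinner x y = cnj (cinner y x)"
    and cinner_add_left: "cinner (x + y) z = cinner x z + cinner y z"
    and cinner_scaleC_left: "cinner (c *\<^sub>C x) y = c * cinner x y"
    and inner_eq_Re_cinner: "inner x y = Re (cinner x y)"

class chilbert_space = complex_inner + complete_space

lemma scaleC_zero_right [simp]: "c *\<^sub>C 0 = (0 :: 'a::complex_vector)"
  using scaleC_add_right[of c "0 :: 'a" 0] by simp

lemma scaleC_minus_right: "c *\<^sub>C (- x) = - (c *\<^sub>C x)" for x :: "'a::complex_vector"
  using scaleC_add_right[of c x "- x"] by (simp add: eq_neg_iff_add_eq_0 add.commute)

lemma scaleC_diff_right: "c *\<^sub>C (x - y) = c *\<^sub>C x - c *\<^sub>C y"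
  for x y :: "'a::complex_vector"
  using scaleC_add_right[of c x "- y"] by (simp add: scaleC_minus_right)

lemma cinner_self: "cinner x x = complex_of_real ((norm x)\<^sup>2)"
  for x :: "'a::complex_inner"
proof (rule complex_eqI)
  show "Re (cinner x x) = Re (complex_of_real ((norm x)\<^sup>2))"
    by (simp add: power2_norm_eq_inner inner_eq_Re_cinner)
  have "Im (cinner x x) = - Im (cinner x x)"
    using arg_cong[OF cinner_commute[of x x], of Im] by simp
  then show "Im (cinner x x) = Im (complex_of_real ((norm x)\<^sup>2))" by simp
qed

lemma cinner_scaleC_right: "cinner x (c *\<^sub>C y) = cnj c * cinner x y"
  for x y :: "'a::complex_inner"
  by (metis cinner_commute cinner_scaleC_left complex_cnj_cnj complex_cnj_mult)

lemma norm_scaleC [simp]: "norm (c *\<^sub>C x) = cmod c * norm x"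
  for x :: "'a::complex_inner"
proof -
  have "complex_of_real ((norm (c *\<^sub>C x))\<^sup>2) = (c * cnj c) * cinner x x"
    unfolding cinner_self[symmetric] cinner_scaleC_left cinner_scaleC_right
    by (simp only: ac_simps)
  also have "\<dots> = complex_of_real ((cmod c * norm x)\<^sup>2)"
    by (simp add: cinner_self complex_norm_square[symmetric] power_mult_distrib)
  finally have "(norm (c *\<^sub>C x))\<^sup>2 = (cmod c * norm x)\<^sup>2"
    using of_real_eq_iff by blast
  then show ?thesis by simp
qed

lemma norm_cinner_le: "cmod (cinner x y) \<le> (norm x)\<^sup>2 + (norm y)\<^sup>2"
  for x y :: "'a::complex_inner"
proof -
  have *: "\<bar>inner u y\<bar> \<le> ((norm u)\<^sup>2 + (norm y)\<^sup>2) / 2" for u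
  proof -
    have "\<bar>inner u y\<bar> \<le> norm u * norm y" by (rule Cauchy_Schwarz_ineq2)
    also have "\<dots> \<le> ((norm u)\<^sup>2 + (norm y)\<^sup>2) / 2"
      using sum_squares_bound[of "norm u" "norm y"] by simp
    finally show ?thesis .
  qed
  have "Im (cinner x y) = inner ((- \<i>) *\<^sub>C x) y"
    by (simp only: inner_eq_Re_cinner cinner_scaleC_left) simp
  then have "\<bar>Im (cinner x y)\<bar> \<le> ((norm x)\<^sup>2 + (norm y)\<^sup>2) / 2"
    using *[of "(- \<i>) *\<^sub>C x"] by simp
  moreover have "\<bar>Re (cinner x y)\<bar> \<le> ((norm x)\<^sup>2 + (norm y)\<^sup>2) / 2"
    using *[of x] by (simp add: inner_eq_Re_cinner)
  ultimately show ?thesis using cmod_le[of "cinner x y"] by (smt (verit) field_sum_of_halves)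
qed

typedef (overloaded) 'a ell2 =
  "{f :: int \<Rightarrow> 'a::complex_inner. (\<lambda>i. (norm (f i))\<^sup>2) summable_on UNIV}"
  morphisms coord Abs_ell2
  by (intro exI[of _ "\<lambda>_. 0"]) simp

setup_lifting type_definition_ell2

lemma ell2_eqI: "(\<And>i. coord f i = coord g i) \<Longrightarrow> f = g"
  by (simp add: coord_inject[symmetric] fun_eq_iff)

lemma ell2_sum_add:
  assumes "(\<lambda>i. (norm (f i))\<^sup>2) summable_on UNIV" "(\<lambda>i. (norm (g i))\<^sup>2) summable_on UNIV"
  shows "(\<lambda>i. (norm (f i + g i :: 'a::real_normed_vector))\<^sup>2) summable_on (UNIV :: int set)"
proof (rule summable_on_comparison_test)
  show "(\<lambda>i. 2 * (norm (f i))\<^sup>2 + 2 * (norm (g i))\<^sup>2) summable_on UNIV"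
    by (intro summable_on_add summable_on_cmult_right assms)
  show "(norm (f i + g i))\<^sup>2 \<le> 2 * (norm (f i))\<^sup>2 + 2 * (norm (g i))\<^sup>2" for i
  proof -
    have "(norm (f i + g i))\<^sup>2 \<le> (norm (f i) + norm (g i))\<^sup>2"
      by (intro power_mono norm_triangle_ineq) simp
    then show ?thesis
      using sum_squares_bound[of "norm (f i)" "norm (g i)"] by (simp add: power2_sum)
  qed
qed simp

instantiation ell2 :: (complex_inner) complex_vector
begin

lift_definition zero_ell2 :: "'a ell2" is "\<lambda>_. 0" by simp
lift_definition plus_ell2 :: "'a ell2 \<Rightarrow> 'a ell2 \<Rightarrow> 'a ell2" is "\<lambda>f g i. f i + g i"
  by (rule ell2_sum_add)
lift_definition uminus_ell2 :: "'a ell2 \<Rightarrow> 'a ell2" is "\<lambda>f i. - f i" by simp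
lift_definition minus_ell2 :: "'a ell2 \<Rightarrow> 'a ell2 \<Rightarrow> 'a ell2" is "\<lambda>f g i. f i - g i"
  subgoal for f g using ell2_sum_add[of f "\<lambda>i. - g i"] by simp
  done
lift_definition scaleR_ell2 :: "real \<Rightarrow> 'a ell2 \<Rightarrow> 'a ell2" is "\<lambda>r f i. r *\<^sub>R f i"
  by (simp add: power_mult_distrib summable_on_cmult_right)
lift_definition scaleC_ell2 :: "complex \<Rightarrow> 'a ell2 \<Rightarrow> 'a ell2" is "\<lambda>c f i. c *\<^sub>C f i"
  by (simp add: power_mult_distrib summable_on_cmult_right)

instance
  by standard
    (transfer; simp add: fun_eq_iff algebra_simps scaleC_add_left scaleC_add_right
      scaleR_scaleC; fail)+

end

lemma ell2_cinner_summable: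
  "(\<lambda>i. cinner (coord f i) (coord g i)) summable_on UNIV"
proof -
  have "(\<lambda>i. norm ((norm (coord f i))\<^sup>2 + (norm (coord g i))\<^sup>2)) summable_on UNIV"
    using summable_on_add[of "\<lambda>i. (norm (coord f i))\<^sup>2" UNIV "\<lambda>i. (norm (coord g i))\<^sup>2"]
      coord[of f] coord[of g] by simp
  then have "(\<lambda>i. norm (cinner (coord f i) (coord g i))) summable_on UNIV"
    by (rule Infinite_Sum.abs_summable_on_comparison_test) (simp add: norm_cinner_le)
  then show ?thesis by (rule Infinite_Sum.abs_summable_summable)
qed

lemma ell2_inner_summable:
  "(\<lambda>i. inner (coord f i) (coord g i)) summable_on UNIV"
  using summable_on_Re[OF ell2_cinner_summable[of f g]] by (simp add: inner_eq_Re_cinner)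

instantiation ell2 :: (complex_inner) complex_inner
begin

definition inner_ell2 :: "'a ell2 \<Rightarrow> 'a ell2 \<Rightarrow> real"
  where "inner_ell2 f g = (\<Sum>\<^sub>\<infinity>i. inner (coord f i) (coord g i))"

definition cinner_ell2 :: "'a ell2 \<Rightarrow> 'a ell2 \<Rightarrow> complex"
  where "cinner_ell2 f g = (\<Sum>\<^sub>\<infinity>i. cinner (coord f i) (coord g i))"

definition norm_ell2 :: "'a ell2 \<Rightarrow> real"
  where "norm_ell2 f = sqrt (inner f f)"

definition sgn_ell2 :: "'a ell2 \<Rightarrow> 'a ell2"
  where "sgn_ell2 f = f /\<^sub>R norm f"

definition dist_ell2 :: "'a ell2 \<Rightarrow> 'a ell2 \<Rightarrow> real"
  where "dist_ell2 f g = norm (f - g)"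

definition uniformity_ell2 :: "('a ell2 \<times> 'a ell2) filter"
  where "uniformity_ell2 = (INF e\<in>{0<..}. principal {(f, g). dist f g < e})"

definition open_ell2 :: "'a ell2 set \<Rightarrow> bool"
  where "open_ell2 U = (\<forall>f\<in>U. eventually (\<lambda>(f', g). f' = f \<longrightarrow> g \<in> U) uniformity)"

instance
proof
  fix f g h :: "'a ell2" and r :: real and c :: complex
  show "dist f g = norm (f - g)" by (rule dist_ell2_def)
  show "sgn f = f /\<^sub>R norm f" by (rule sgn_ell2_def)
  show "uniformity = (INF e\<in>{0<..}. principal {(f, g :: 'a ell2). dist f g < e})"
    by (rule uniformity_ell2_def)
  show "open U = (\<forall>f\<in>U. eventually (\<lambda>(f', g). f' = f \<longrightarrow> g \<in> U) uniformity)"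
    for U :: "'a ell2 set" by (rule open_ell2_def)
  show "norm f = sqrt (inner f f)" by (rule norm_ell2_def)
  show "inner f g = inner g f" by (simp add: inner_ell2_def inner_commute)
  show "inner (f + g) h = inner f h + inner g h"
    by (simp add: inner_ell2_def plus_ell2.rep_eq inner_add_left infsum_add ell2_inner_summable)
  show "inner (r *\<^sub>R f) g = r * inner f g"
    by (simp add: inner_ell2_def scaleR_ell2.rep_eq infsum_cmult_right')
  show "0 \<le> inner f f" by (simp add: inner_ell2_def infsum_nonneg)
  show "inner f f = 0 \<longleftrightarrow> f = 0"
  proof
    assume *: "inner f f = 0"
    have "inner (coord f i) (coord f i) = 0" for i
      by (rule nonneg_infsum_le_0D[of _ UNIV])
        (use * ell2_inner_summable in \<open>auto simp: inner_ell2_def\<close>)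
    then show "f = 0" by (intro ell2_eqI) (simp add: zero_ell2.rep_eq)
  qed (simp add: inner_ell2_def zero_ell2.rep_eq)
  show "cinner f g = cnj (cinner g f)"
    by (simp add: cinner_ell2_def infsum_cnj[symmetric] cinner_commute[symmetric] del: infsum_cnj)
  show "cinner (f + g) h = cinner f h + cinner g h"
    by (simp add: cinner_ell2_def plus_ell2.rep_eq cinner_add_left infsum_add
        ell2_cinner_summable)
  show "cinner (c *\<^sub>C f) g = c * cinner f g"
    by (simp add: cinner_ell2_def scaleC_ell2.rep_eq cinner_scaleC_left infsum_cmult_right')
  show "inner f g = Re (cinner f g)"
    by (simp add: inner_ell2_def cinner_ell2_def inner_eq_Re_cinner infsum_Re ell2_cinner_summable)
qed

end

lemma ell2_norm_summable: "(\<lambda>i. (norm (coord f i))\<^sup>2) summable_on UNIV"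
  using coord[of f] by simp

lemma norm_ell2_square: "(norm f)\<^sup>2 = (\<Sum>\<^sub>\<infinity>i. (norm (coord f i))\<^sup>2)"
  by (simp add: power2_norm_eq_inner inner_ell2_def)

lemma norm_coord_le: "norm (coord f i) \<le> norm f"
proof (rule power2_le_imp_le)
  show "(norm (coord f i))\<^sup>2 \<le> (norm f)\<^sup>2"
    unfolding norm_ell2_square
    using finite_sum_le_infsum[OF ell2_norm_summable[of f], of "{i}"] by simp
qed simp

instance ell2 :: (chilbert_space) chilbert_space
proof
  fix X :: "nat \<Rightarrow> 'a ell2"
  assume X: "Cauchy X"
  have "Cauchy (\<lambda>n. coord (X n) i)" for i
  proof (rule CauchyI)
    fix e :: real assume "0 < e"
    then obtain M where M: "norm (X m - X n) < e" if "m \<ge> M" "n \<ge> M" for m n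
      using CauchyD[OF X] by blast
    have "norm (coord (X m) i - coord (X n) i) < e" if "m \<ge> M" "n \<ge> M" for m n
      using norm_coord_le[of "X m - X n" i] M[OF that] by (simp add: minus_ell2.rep_eq)
    then show "\<exists>M. \<forall>m\<ge>M. \<forall>n\<ge>M. norm (coord (X m) i - coord (X n) i) < e" by blast
  qed
  then have "convergent (\<lambda>n. coord (X n) i)" for i
    by (rule Cauchy_convergent)
  then obtain l where l: "(\<lambda>n. coord (X n) i) \<longlonglongrightarrow> l i" for i
    unfolding convergent_def by metis
  have bound: "(\<lambda>i. (norm (coord (X m) i - l i))\<^sup>2) summable_on UNIV \<and>
      (\<Sum>\<^sub>\<infinity>i. (norm (coord (X m) i - l i))\<^sup>2) \<le> e\<^sup>2"
    if M: "\<And>n. n \<ge> M \<Longrightarrow> norm (X m - X n) < e" for m M :: nat and e :: real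
  proof -
    have fin: "(\<Sum>i\<in>F. (norm (coord (X m) i - l i))\<^sup>2) \<le> e\<^sup>2" if "finite F" for F
    proof (rule LIMSEQ_le_const2)
      show "(\<lambda>n. \<Sum>i\<in>F. (norm (coord (X m) i - coord (X n) i))\<^sup>2)
          \<longlonglongrightarrow> (\<Sum>i\<in>F. (norm (coord (X m) i - l i))\<^sup>2)"
        by (intro tendsto_intros l)
      have "(\<Sum>i\<in>F. (norm (coord (X m) i - coord (X n) i))\<^sup>2) \<le> e\<^sup>2" if "n \<ge> M" for n
      proof -
        have "(\<Sum>i\<in>F. (norm (coord (X m - X n) i))\<^sup>2) \<le> (norm (X m - X n))\<^sup>2"
          unfolding norm_ell2_square
          using finite_sum_le_infsum[OF ell2_norm_summable \<open>finite F\<close>] by simp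
        also have "\<dots> \<le> e\<^sup>2" using M[OF that] by (intro power_mono) auto
        finally show ?thesis by (simp add: minus_ell2.rep_eq)
      qed
      then show "\<exists>N. \<forall>n\<ge>N. (\<Sum>i\<in>F. (norm (coord (X m) i - coord (X n) i))\<^sup>2) \<le> e\<^sup>2"
        by blast
    qed
    have "(\<lambda>i. (norm (coord (X m) i - l i))\<^sup>2) summable_on UNIV"
      by (rule nonneg_bdd_above_summable_on) (auto intro!: bdd_aboveI2 fin)
    moreover from this have "(\<Sum>\<^sub>\<infinity>i. (norm (coord (X m) i - l i))\<^sup>2) \<le> e\<^sup>2"
      by (rule infsum_le_finite_sums) (rule fin)
    ultimately show ?thesis ..
  qed
  obtain M where M: "norm (X m - X n) < 1" if "m \<ge> M" "n \<ge> M" for m n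
    using CauchyD[OF X zero_less_one] by blast
  have "(\<lambda>i. (norm (coord (X M) i - l i))\<^sup>2) summable_on UNIV"
    using bound[OF M[OF order_refl]] by blast
  from ell2_sum_add[OF ell2_norm_summable[of "X M"], of "\<lambda>i. - (coord (X M) i - l i)"] this
  have "(\<lambda>i. (norm (l i))\<^sup>2) summable_on UNIV" by (simp add: norm_minus_commute)
  then have L: "coord (Abs_ell2 l) = l" by (simp add: Abs_ell2_inverse)
  have "X \<longlonglongrightarrow> Abs_ell2 l"
  proof (rule LIMSEQ_I)
    fix r :: real assume "0 < r"
    then obtain M where M: "norm (X m - X n) < r / 2" if "m \<ge> M" "n \<ge> M" for m n
      using CauchyD[OF X, of "r / 2"] by (meson half_gt_zero)
    have "norm (X m - Abs_ell2 l) < r" if "m \<ge> M" for m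
    proof -
      have "(norm (X m - Abs_ell2 l))\<^sup>2 \<le> (r / 2)\<^sup>2"
        using bound[OF M[OF that]]
        by (simp add: norm_ell2_square minus_ell2.rep_eq L)
      then have "norm (X m - Abs_ell2 l) \<le> r / 2"
        by (rule power2_le_imp_le) (use \<open>0 < r\<close> in simp)
      then show ?thesis using \<open>0 < r\<close> by linarith
    qed
    then show "\<exists>no. \<forall>n\<ge>no. norm (X n - Abs_ell2 l) < r" by blast
  qed
  then show "convergent X" by (rule convergentI)
qed

text \<open>
  The type \<open>'a bop\<close> is the algebra of bounded complex-linear operators on \<open>'a\<close>, with
  composition as multiplication and the operator norm. It is not of class ring_1, because
  \<open>0 = 1\<close> when the space is trivial.
\<close>

typedef (overloaded) 'a bop =
  "{T :: 'a::complex_inner \<Rightarrow>\<^sub>L 'a. \<forall>c x. T (c *\<^sub>C x) = c *\<^sub>C T x}"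
  morphisms blinfun_of_bop Abs_bop
  by (intro exI[of _ id_blinfun]) simp

setup_lifting type_definition_bop

lift_definition bop_apply :: "'a::complex_inner bop \<Rightarrow> 'a \<Rightarrow> 'a" (infixr "*\<^sub>V" 70)
  is blinfun_apply .

lemma bop_apply_add_right: "T *\<^sub>V (x + y) = T *\<^sub>V x + T *\<^sub>V y"
  by (simp add: bop_apply.rep_eq blinfun.add_right)

lemma bop_apply_scaleR_right: "T *\<^sub>V (r *\<^sub>R x) = r *\<^sub>R (T *\<^sub>V x)"
  by (simp add: bop_apply.rep_eq blinfun.scaleR_right)

lemma bop_eqI: "(\<And>x. T *\<^sub>V x = U *\<^sub>V x) \<Longrightarrow> T = U"
  by transfer (rule blinfun_eqI)

lift_definition blinfun_scaleC :: "complex \<Rightarrow> 'a::complex_inner \<Rightarrow>\<^sub>L 'a" is "(*\<^sub>C)"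
  subgoal for c
    by (rule bounded_linear_intro[where K = "cmod c"])
      (simp_all add: scaleC_add_right scaleR_scaleC mult.commute)
  done

instantiation bop :: (complex_inner) complex_vector
begin

lift_definition zero_bop :: "'a bop" is "0 :: 'a \<Rightarrow>\<^sub>L 'a" by simp
lift_definition plus_bop :: "'a bop \<Rightarrow> 'a bop \<Rightarrow> 'a bop"
  is "(+) :: ('a \<Rightarrow>\<^sub>L 'a) \<Rightarrow> _"
  by (simp add: blinfun.add_left scaleC_add_right)
lift_definition uminus_bop :: "'a bop \<Rightarrow> 'a bop"
  is "uminus :: ('a \<Rightarrow>\<^sub>L 'a) \<Rightarrow> _"
  by (simp add: blinfun.minus_left scaleC_minus_right)
lift_definition minus_bop :: "'a bop \<Rightarrow> 'a bop \<Rightarrow> 'a bop"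
  is "(-) :: ('a \<Rightarrow>\<^sub>L 'a) \<Rightarrow> _"
  by (simp add: blinfun.diff_left scaleC_diff_right)
lift_definition scaleR_bop :: "real \<Rightarrow> 'a bop \<Rightarrow> 'a bop"
  is "(*\<^sub>R) :: real \<Rightarrow> ('a \<Rightarrow>\<^sub>L 'a) \<Rightarrow> _"
  by (simp add: blinfun.scaleR_left scaleR_scaleC mult.commute)
lift_definition scaleC_bop :: "complex \<Rightarrow> 'a bop \<Rightarrow> 'a bop"
  is "\<lambda>c (T :: 'a \<Rightarrow>\<^sub>L 'a). blinfun_scaleC c o\<^sub>L T"
  by (simp add: blinfun_scaleC.rep_eq mult.commute)

lemma bop_apply_linear [simp]:
  fixes T U :: "'a bop"
  shows "0 *\<^sub>V x = 0" "(T + U) *\<^sub>V x = T *\<^sub>V x + U *\<^sub>V x" "(- T) *\<^sub>V x = - (T *\<^sub>V x)"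
    "(T - U) *\<^sub>V x = T *\<^sub>V x - U *\<^sub>V x" "(r *\<^sub>R T) *\<^sub>V x = r *\<^sub>R (T *\<^sub>V x)"
    "(c *\<^sub>C T) *\<^sub>V x = c *\<^sub>C (T *\<^sub>V x)"
  by (simp_all add: bop_apply.rep_eq zero_bop.rep_eq plus_bop.rep_eq uminus_bop.rep_eq
      minus_bop.rep_eq scaleR_bop.rep_eq scaleC_bop.rep_eq blinfun_scaleC.rep_eq
      blinfun.add_left blinfun.minus_left blinfun.diff_left blinfun.scaleR_left)

instance
  by standard
    (rule bop_eqI; simp add: algebra_simps scaleC_add_left scaleC_add_right scaleR_scaleC[symmetric]; fail)+

end

instantiation bop :: (complex_inner) "{real_normed_algebra, monoid_mult}"
begin

lift_definition one_bop :: "'a bop" is "id_blinfun :: 'a \<Rightarrow>\<^sub>L 'a" by simp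
lift_definition times_bop :: "'a bop \<Rightarrow> 'a bop \<Rightarrow> 'a bop"
  is "(o\<^sub>L) :: ('a \<Rightarrow>\<^sub>L 'a) \<Rightarrow> _" by simp
lift_definition norm_bop :: "'a bop \<Rightarrow> real" is "norm :: ('a \<Rightarrow>\<^sub>L 'a) \<Rightarrow> _" .

lemma bop_apply_mult [simp]:
  fixes T U :: "'a bop"
  shows "1 *\<^sub>V x = x" "(T * U) *\<^sub>V x = T *\<^sub>V U *\<^sub>V x"
  by (simp_all add: bop_apply.rep_eq one_bop.rep_eq times_bop.rep_eq)

definition sgn_bop :: "'a bop \<Rightarrow> 'a bop"
  where "sgn_bop T = T /\<^sub>R norm T"

definition dist_bop :: "'a bop \<Rightarrow> 'a bop \<Rightarrow> real"
  where "dist_bop T U = norm (T - U)"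

definition uniformity_bop :: "('a bop \<times> 'a bop) filter"
  where "uniformity_bop = (INF e\<in>{0<..}. principal {(T, U). dist T U < e})"

definition open_bop :: "'a bop set \<Rightarrow> bool"
  where "open_bop A = (\<forall>T\<in>A. eventually (\<lambda>(T', U). T' = T \<longrightarrow> U \<in> A) uniformity)"

instance
proof
  fix T U V :: "'a bop" and r :: real
  show "dist T U = norm (T - U)" by (rule dist_bop_def)
  show "sgn T = T /\<^sub>R norm T" by (rule sgn_bop_def)
  show "uniformity = (INF e\<in>{0<..}. principal {(T, U :: 'a bop). dist T U < e})"
    by (rule uniformity_bop_def)
  show "open A = (\<forall>T\<in>A. eventually (\<lambda>(T', U). T' = T \<longrightarrow> U \<in> A) uniformity)"
    for A :: "'a bop set" by (rule open_bop_def)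
  show "T * U * V = T * (U * V)" "1 * T = T" "T * 1 = T"
    "(T + U) * V = T * V + U * V" "T * (U + V) = T * U + T * V"
    "r *\<^sub>R T * U = r *\<^sub>R (T * U)" "T * r *\<^sub>R U = r *\<^sub>R (T * U)"
    by (rule bop_eqI; simp add: bop_apply_add_right bop_apply_scaleR_right)+
  show "norm T = 0 \<longleftrightarrow> T = 0"
    by (simp add: norm_bop.rep_eq blinfun_of_bop_inject[symmetric] zero_bop.rep_eq)
  show "norm (T + U) \<le> norm T + norm U"
    by (simp add: norm_bop.rep_eq plus_bop.rep_eq norm_triangle_ineq)
  show "norm (r *\<^sub>R T) = \<bar>r\<bar> * norm T"
    by (simp add: norm_bop.rep_eq scaleR_bop.rep_eq)
  show "norm (T * U) \<le> norm T * norm U"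
    by (simp add: norm_bop.rep_eq times_bop.rep_eq norm_blinfun_compose)
qed

end

text \<open>Existence of the adjoint is the Riesz representation theorem.\<close>

definition adj :: "'a::chilbert_space bop \<Rightarrow> 'a bop"
  where "adj T = (THE U. \<forall>x y. cinner (T *\<^sub>V x) y = cinner x (U *\<^sub>V y))"

definition invertible_bop :: "'a::complex_inner bop \<Rightarrow> bool"
  where "invertible_bop T \<longleftrightarrow> (\<exists>U. T * U = 1 \<and> U * T = 1)"

definition inverse_bop :: "'a::complex_inner bop \<Rightarrow> 'a bop"
  where "inverse_bop T = (THE U. T * U = 1 \<and> U * T = 1)"

definition positive_bop :: "'a::complex_inner bop \<Rightarrow> bool"
  where "positive_bop A \<longleftrightarrow> (\<forall>x. cinner (A *\<^sub>V x) x \<in> \<real>\<^sub>\<ge>\<^sub>0)"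

text \<open>A positive operator on a Hilbert space has exactly one positive square root.\<close>

definition sqrt_bop :: "'a::complex_inner bop \<Rightarrow> 'a bop"
  where "sqrt_bop A = (SOME R. positive_bop R \<and> R\<^sup>2 = A)"

definition modulus :: "'a::chilbert_space bop \<Rightarrow> 'a bop"
  where "modulus T = sqrt_bop (adj T * T)"

definition m_isometric :: "nat \<Rightarrow> 'a::chilbert_space bop \<Rightarrow> bool"
  where "m_isometric m T \<longleftrightarrow>
    (\<Sum>k\<le>m. (real (m choose k) * (- 1) ^ (m - k)) *\<^sub>R (adj T ^ k * T ^ k)) = 0"

definition bilateral_weighted_shift ::
    "(int \<Rightarrow> 'a::complex_inner bop) \<Rightarrow> 'a ell2 bop \<Rightarrow> bool"
  where "bilateral_weighted_shift W S \<longleftrightarrow>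
    bounded (range W) \<and> (\<forall>h i. coord (S *\<^sub>V h) i = W i *\<^sub>V coord h (i - 1))"

definition bop_polys :: "nat \<Rightarrow> (complex \<Rightarrow> 'a::complex_inner bop) set"
  where "bop_polys n = {p. \<exists>A. \<forall>z. p z = (\<Sum>j\<le>n. z ^ j *\<^sub>C A j)}"

text \<open>
  With \<open>[a..b]\<close> the increasing list of integers, the two products below are
  \<open>W n * \<dots> * W 1\<close> and \<open>adj (W (- n + 1)) * \<dots> * adj (W 0)\<close>.
\<close>

definition interpolates_weights ::
    "(int \<Rightarrow> 'a::chilbert_space bop) \<Rightarrow> (complex \<Rightarrow> 'a bop) \<Rightarrow> bool"
  where "interpolates_weights W p \<longleftrightarrow> p 0 = 1 \<and>
    (\<forall>n::int. 1 \<le> n \<longrightarrow>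
      p (of_int n) = (modulus (\<Prod>i\<leftarrow>rev [1..n]. W i))\<^sup>2 \<and>
      p (of_int (- n)) = inverse_bop ((modulus (\<Prod>i\<leftarrow>[- n + 1..0]. adj (W i)))\<^sup>2))"

end

theory Submission
  imports Defs
begin

text \<open>
  Let \<open>Q\<close> be the two-sided solution of \<open>Q n = W n * Q (n - 1)\<close> with \<open>Q 0 = 1\<close>, and put
  \<open>a n = adj (Q n) * Q n\<close>; the interpolation conditions say exactly that \<open>p n = a n\<close> for every
  integer \<open>n\<close>. Since \<open>W (i + k) * \<dots> * W (i + 1) = Q (i + k) * inverse (Q i)\<close>, the operator in the
  definition of an \<open>m\<close>-isometry is diagonal, and its entry at \<open>i\<close> is congruent, via \<open>Q i\<close>, to the
  \<open>m\<close>-th finite difference of \<open>a\<close> at \<open>i\<close>. So \<open>S\<close> is \<open>m\<close>-isometric iff all \<open>m\<close>-th differences of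
  \<open>a\<close> vanish, that is, by Newton interpolation, iff \<open>a\<close> is a polynomial of degree below \<open>m\<close>.
  The quotient in the norm formula is \<open>(norm (W (n + 1) y) / norm y)\<^sup>2\<close> with \<open>y = Q n h\<close>, and the norm
  of the shift is the supremum of the norms of its weights.
\<close>

section \<open>Operators on a Hilbert space\<close>

instance chilbert_space \<subseteq> banach ..

text \<open>The minimiser of \<open>J x = (norm x)^2 - 2 * f x\<close> represents \<open>f\<close>.
  A minimising sequence is Cauchy by the parallelogram law, and stationarity at the limit is the
  claimed identity.\<close>

lemma riesz_representation:
  fixes f :: "'a::{real_inner, complete_space} \<Rightarrow> real"
  assumes f: "bounded_linear f"
  obtains z where "\<And>x. f x = inner x z"
proof -
  interpret f: bounded_linear f by fact
  define J where "J x = (norm x)\<^sup>2 - 2 * f x" for x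
  obtain K where K: "\<And>x. norm (f x) \<le> norm x * K" using f.bounded by blast
  have lower: "- K\<^sup>2 \<le> J x" for x
  proof -
    have "2 * f x \<le> 2 * (norm x * K)" using K[of x] by simp
    also have "\<dots> \<le> (norm x)\<^sup>2 + K\<^sup>2" using sum_squares_bound[of "norm x" K] by simp
    finally show ?thesis by (simp add: J_def)
  qed
  define d where "d = Inf (range J)"
  have bdd: "bdd_below (range J)" by (rule bdd_belowI2[of _ "- K\<^sup>2"]) (rule lower)
  have d_le: "d \<le> J x" for x unfolding d_def by (rule cInf_lower[OF _ bdd]) simp
  have "\<exists>x. J x < d + 1 / real (Suc n)" for n
    using cInf_lessD[of "range J" "d + 1 / real (Suc n)"] by (auto simp: d_def)
  then obtain X where X: "J (X n) < d + 1 / real (Suc n)" for n by metis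
  \<comment> \<open>The midpoint of \<open>x\<close> and \<open>y\<close> also has \<open>J\<close>
    at least \<open>d\<close>, so two near-minimisers are close.\<close>
  have mid: "(norm (x - y))\<^sup>2 \<le> 2 * (J x - d) + 2 * (J y - d)" for x y
  proof -
    have "J ((1/2) *\<^sub>R (x + y)) = (J x + J y) / 2 - (norm (x - y))\<^sup>2 / 4"
      unfolding J_def
      by (simp add: f.add f.scaleR power2_norm_eq_inner inner_add_left inner_add_right
          inner_diff_left inner_diff_right inner_commute[of y x] field_simps)
    then show ?thesis using d_le[of "(1/2) *\<^sub>R (x + y)"] by (simp add: field_simps)
  qed
  have "Cauchy X"
  proof (rule CauchyI)
    fix e :: real assume "0 < e"
    then obtain M where M: "inverse (real (Suc M)) < e\<^sup>2 / 4"
      using reals_Archimedean[of "e\<^sup>2 / 4"] by auto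
    have "norm (X m - X n) < e" if "M \<le> m" "M \<le> n" for m n
    proof -
      have small: "J (X k) - d < e\<^sup>2 / 4" if "M \<le> k" for k
      proof -
        have "1 / real (Suc k) \<le> inverse (real (Suc M))"
          using that by (simp add: inverse_eq_divide frac_le)
        then show ?thesis using X[of k] M by linarith
      qed
      have "(norm (X m - X n))\<^sup>2 \<le> 2 * (J (X m) - d) + 2 * (J (X n) - d)" by (rule mid)
      also have "\<dots> < 2 * (e\<^sup>2 / 4) + 2 * (e\<^sup>2 / 4)"
        by (intro add_strict_mono mult_strict_left_mono small that) simp_all
      finally have "(norm (X m - X n))\<^sup>2 < e\<^sup>2" by simp
      then show ?thesis using \<open>0 < e\<close> by (simp add: power_less_imp_less_base)
    qed
    then show "\<exists>M. \<forall>m\<ge>M. \<forall>n\<ge>M. norm (X m - X n) < e" by blast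
  qed
  then obtain z where z: "X \<longlonglongrightarrow> z" using Cauchy_convergent convergent_def by blast
  have "(\<lambda>n. J (X n)) \<longlonglongrightarrow> J z"
    unfolding J_def by (intro tendsto_intros z f.tendsto)
  moreover have "(\<lambda>n. d + 1 / real (Suc n)) \<longlonglongrightarrow> d"
    using tendsto_add[OF tendsto_const LIMSEQ_inverse_real_of_nat, of d]
    by (simp add: inverse_eq_divide)
  ultimately have "J z \<le> d"
    by (rule LIMSEQ_le) (use X less_imp_le in blast)
  have "f x = inner x z" for x
  proof -
    \<comment> \<open>This is \<open>J (z + t x) - J z\<close>, nonnegative because \<open>z\<close>
      attains the infimum.\<close>
    have quad: "0 \<le> t\<^sup>2 * (norm x)\<^sup>2 + 2 * t * (inner x z - f x)" for t
    proof -
      have "(norm (z + t *\<^sub>R x))\<^sup>2 = (norm z)\<^sup>2 + 2 * t * inner x z + t\<^sup>2 * (norm x)\<^sup>2"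
        unfolding power2_norm_eq_inner
        by (simp add: inner_add_left inner_add_right inner_commute[of z x] power2_eq_square
            algebra_simps)
      then show ?thesis using d_le[of "z + t *\<^sub>R x"] \<open>J z \<le> d\<close>
        by (simp add: J_def f.add f.scaleR algebra_simps)
    qed
    define c where "c = inner x z - f x"
    \<comment> \<open>The choice \<open>t = - c / N\<close> nearly minimises the quadratic; the
      added 1 keeps \<open>N\<close> positive when \<open>x = 0\<close>.\<close>
    define N where "N = (norm x)\<^sup>2 + 1"
    have N: "N > 0" by (simp add: N_def add_nonneg_pos)
    have "0 \<le> (c / N)\<^sup>2 * (norm x)\<^sup>2 - 2 * (c / N) * c"
      using quad[of "- (c / N)"] by (simp add: c_def)
    also have "\<dots> \<le> (c / N)\<^sup>2 * N - 2 * (c / N) * c"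
      by (simp add: N_def mult_left_mono)
    also have "\<dots> = - (c\<^sup>2 / N)" using N by (simp add: field_simps power2_eq_square)
    finally have "c\<^sup>2 / N \<le> 0" by simp
    then have "c = 0" using N by (simp add: divide_le_0_iff)
    then show ?thesis by (simp add: c_def)
  qed
  then show thesis by (rule that)
qed

text \<open>Reduces complex inner product identities to real ones: for a complex-linear
  \<open>T\<close> the factor \<open>- \<i>\<close> moves inside, so the imaginary part is one more
  instance of the real identity.\<close>

lemma Im_cinner: "Im (cinner x y) = inner ((- \<i>) *\<^sub>C x) y"
  for x y :: "'a::complex_inner"
  by (simp only: inner_eq_Re_cinner cinner_scaleC_left) simp

lemma bop_apply_scaleC_right: "T *\<^sub>V (c *\<^sub>C x) = c *\<^sub>C (T *\<^sub>V x)"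
  by transfer simp

lemma norm_bop_apply: "norm (T *\<^sub>V x) \<le> norm T * norm x"
  by (simp add: bop_apply.rep_eq norm_bop.rep_eq norm_blinfun)

lemma norm_bop_bound:
  assumes "0 \<le> c" "\<And>x. norm (T *\<^sub>V x) \<le> c * norm x"
  shows "norm T \<le> c"
  using assms by transfer (rule norm_blinfun_bound)

lemma bounded_linear_bop_apply: "bounded_linear (\<lambda>x. T *\<^sub>V x)"
  by (simp add: bop_apply.rep_eq blinfun.bounded_linear_right)

lemma cinner_extensionality:
  fixes x y :: "'a::complex_inner"
  assumes "\<And>z. cinner z x = cinner z y"
  shows "x = y"
proof -
  have "inner (x - y) (x - y) = 0"
    by (simp only: inner_diff_right) (simp add: inner_eq_Re_cinner assms)
  then show ?thesis by simp
qed

lemma cinner_eqI_inner: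
  fixes T U :: "'a::complex_inner bop"
  assumes "\<And>x y. inner (T *\<^sub>V x) y = inner x (U *\<^sub>V y)"
  shows "cinner (T *\<^sub>V x) y = cinner x (U *\<^sub>V y)"
proof (rule complex_eqI)
  show "Re (cinner (T *\<^sub>V x) y) = Re (cinner x (U *\<^sub>V y))"
    using assms by (simp add: inner_eq_Re_cinner)
  show "Im (cinner (T *\<^sub>V x) y) = Im (cinner x (U *\<^sub>V y))"
    unfolding Im_cinner bop_apply_scaleC_right[symmetric] by (rule assms)
qed

text \<open>For fixed \<open>y\<close>, the real functional \<open>inner (T x) y\<close> of
  \<open>x\<close> is represented by a vector \<open>u y\<close>. Uniqueness of representing vectors
  makes \<open>u\<close> linear, and Cauchy-Schwarz bounds it by \<open>norm T\<close>.\<close>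

lemma adjoint_exists:
  fixes T :: "'a::chilbert_space bop"
  shows "\<exists>U. \<forall>x y. cinner (T *\<^sub>V x) y = cinner x (U *\<^sub>V y)"
proof -
  have "\<exists>z. \<forall>x. inner (T *\<^sub>V x) y = inner x z" for y
  proof -
    have "bounded_linear (\<lambda>x. inner (T *\<^sub>V x) y)"
      by (rule bounded_linear_compose[OF bounded_linear_inner_left bounded_linear_bop_apply])
    then show ?thesis using riesz_representation by blast
  qed
  then obtain u where u: "inner (T *\<^sub>V x) y = inner x (u y)" for x y by metis
  have ext: "a = b" if "\<And>x. inner x a = inner x b" for a b :: 'a
    using that[of "a - b"] inner_eq_zero_iff[of "a - b"] by (simp add: inner_diff_right)
  have cu: "cinner (T *\<^sub>V x) y = cinner x (u y)" for x y
  proof (rule complex_eqI)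
    show "Re (cinner (T *\<^sub>V x) y) = Re (cinner x (u y))"
      using u by (simp add: inner_eq_Re_cinner)
    show "Im (cinner (T *\<^sub>V x) y) = Im (cinner x (u y))"
      unfolding Im_cinner bop_apply_scaleC_right[symmetric] by (rule u)
  qed
  have bl: "bounded_linear u"
  proof (rule bounded_linear_intro[where K = "norm T"])
    show "u (x + y) = u x + u y" for x y
      by (rule ext) (simp add: u[symmetric] inner_add_right)
    show "u (r *\<^sub>R x) = r *\<^sub>R u x" for r x
      by (rule ext) (simp add: u[symmetric])
    show "norm (u x) \<le> norm x * norm T" for x
    proof (cases "u x = 0")
      case False
      have "(norm (u x))\<^sup>2 = inner (T *\<^sub>V u x) x" by (simp add: u power2_norm_eq_inner)
      also have "\<dots> \<le> norm (T *\<^sub>V u x) * norm x" by (rule norm_cauchy_schwarz)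
      also have "\<dots> \<le> norm T * norm (u x) * norm x"
        by (intro mult_right_mono norm_bop_apply) simp
      finally show ?thesis using False by (simp add: power2_eq_square mult.commute mult_le_cancel_left)
    qed simp
  qed
  have "u (c *\<^sub>C x) = c *\<^sub>C u x" for c x
    by (rule cinner_extensionality) (simp add: cu[symmetric] cinner_scaleC_right)
  then have "blinfun_of_bop (Abs_bop (Blinfun u)) = Blinfun u"
    by (intro Abs_bop_inverse) (simp add: bounded_linear_Blinfun_apply bl)
  then have "Abs_bop (Blinfun u) *\<^sub>V y = u y" for y
    by (simp add: bop_apply.rep_eq bounded_linear_Blinfun_apply bl)
  then show ?thesis using cu by metis
qed

lemma adj_eqI:
  fixes T U :: "'a::chilbert_space bop"
  assumes "\<And>x y. cinner (T *\<^sub>V x) y = cinner x (U *\<^sub>V y)"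
  shows "adj T = U"
  unfolding adj_def
proof (rule the_equality)
  fix V assume "\<forall>x y. cinner (T *\<^sub>V x) y = cinner x (V *\<^sub>V y)"
  then show "V = U" by (intro bop_eqI cinner_extensionality) (simp add: assms[symmetric])
qed (use assms in blast)

lemma cinner_adj_right: "cinner x (adj T *\<^sub>V y) = cinner (T *\<^sub>V x) y"
  for T :: "'a::chilbert_space bop"
proof -
  obtain U where "\<And>x y. cinner (T *\<^sub>V x) y = cinner x (U *\<^sub>V y)"
    using adjoint_exists[of T] by blast
  then show ?thesis using adj_eqI[of T U] by simp
qed

lemma cinner_adj_left: "cinner (adj T *\<^sub>V x) y = cinner x (T *\<^sub>V y)"
  for T :: "'a::chilbert_space bop"
  by (metis cinner_adj_right cinner_commute)

lemma adj_one [simp]: "adj 1 = (1 :: 'a::chilbert_space bop)"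
  by (rule adj_eqI) simp

lemma adj_adj [simp]: "adj (adj T) = (T :: 'a::chilbert_space bop)"
  by (rule adj_eqI) (simp add: cinner_adj_left)

lemma adj_mult: "adj (T * U) = adj U * adj (T :: 'a::chilbert_space bop)"
  by (rule adj_eqI) (simp add: cinner_adj_right)

text \<open>Complex linearity survives limits in norm. Completeness is what the fixed point argument
  for square roots rests on.\<close>

instance bop :: (chilbert_space) banach
proof
  fix X :: "nat \<Rightarrow> 'a bop" assume "Cauchy X"
  have diff: "norm (blinfun_of_bop T - blinfun_of_bop U) = norm (T - U)" for T U :: "'a bop"
    by (simp add: norm_bop.rep_eq minus_bop.rep_eq)
  have "Cauchy (\<lambda>n. blinfun_of_bop (X n))"
    using \<open>Cauchy X\<close> by (simp add: Cauchy_def dist_norm diff)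
  then obtain L where L: "(\<lambda>n. blinfun_of_bop (X n)) \<longlonglongrightarrow> L"
    using Cauchy_convergent convergent_def by blast
  have lim: "(\<lambda>n. blinfun_of_bop (X n) x) \<longlonglongrightarrow> L x" for x
    by (rule bounded_linear.tendsto[OF blinfun.bounded_linear_left L])
  have "L (c *\<^sub>C x) = c *\<^sub>C L x" for c x
  proof (rule LIMSEQ_unique)
    show "(\<lambda>n. blinfun_of_bop (X n) (c *\<^sub>C x)) \<longlonglongrightarrow> L (c *\<^sub>C x)" by (rule lim)
    have "(\<lambda>n. blinfun_scaleC c (blinfun_of_bop (X n) x)) \<longlonglongrightarrow> blinfun_scaleC c (L x)"
      by (rule bounded_linear.tendsto[OF blinfun.bounded_linear_right lim])
    then show "(\<lambda>n. blinfun_of_bop (X n) (c *\<^sub>C x)) \<longlonglongrightarrow> c *\<^sub>C L x"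
      using blinfun_of_bop[of "X _"] by (simp add: blinfun_scaleC.rep_eq)
  qed
  then have "blinfun_of_bop (Abs_bop L) = L" by (simp add: Abs_bop_inverse)
  then have "X \<longlonglongrightarrow> Abs_bop L"
    using L by (metis (no_types, lifting) LIMSEQ_iff diff)
  then show "convergent X" by (rule convergentI)
qed

lemma bounded_linear_bop_apply_left: "bounded_linear (\<lambda>T. T *\<^sub>V x)"
  by (rule bounded_linear_intro[where K = "norm x"]) (simp_all add: norm_bop_apply)

section \<open>Square roots of invertible positive operators\<close>

text \<open>The real inner product suffices, since \<open>cinner_eqI_inner\<close> recovers the
  complex identity. In this form each instance equates two continuous functions of \<open>T\<close>,
  so the condition is closed.\<close>

definition selfadjoint_bop :: "'a::complex_inner bop \<Rightarrow> bool"
  where "selfadjoint_bop T \<longleftrightarrow> (\<forall>x y. inner (T *\<^sub>V x) y = inner x (T *\<^sub>V y))"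

lemma closed_selfadjoint_bop: "closed {T :: 'a::complex_inner bop. selfadjoint_bop T}"
  unfolding selfadjoint_bop_def
  by (intro closed_Collect_all closed_Collect_eq continuous_intros
      linear_continuous_on bounded_linear_bop_apply_left)

lemma selfadjoint_bop_in_Reals:
  assumes "selfadjoint_bop T"
  shows "cinner (T *\<^sub>V x) x \<in> \<real>"
proof -
  have "cinner (T *\<^sub>V x) x = cinner x (T *\<^sub>V x)"
    by (rule cinner_eqI_inner) (use assms in \<open>simp add: selfadjoint_bop_def\<close>)
  also have "\<dots> = cnj (cinner (T *\<^sub>V x) x)" by (rule cinner_commute)
  finally show ?thesis by (simp add: Reals_cnj_iff)
qed

text \<open>The equation \<open>(1 - Y)\<^sup>2 = 1 - B\<close> reads \<open>Y = (B + Y\<^sup>2) / 2\<close>, and the right-hand side is a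
  contraction of the ball of radius \<open>r < 1\<close> as soon as \<open>norm B \<le> 2 * r - r\<^sup>2\<close>.\<close>

lemma sqrt_one_minus:
  fixes B :: "'a::chilbert_space bop"
  assumes B: "selfadjoint_bop B" "norm B < 1"
  obtains Y where "selfadjoint_bop Y" "norm Y \<le> 1" "(1 - Y)\<^sup>2 = 1 - B"
proof -
  \<comment> \<open>The smaller root of \<open>r^2 - 2 * r + norm B = 0\<close>, so that
    \<open>F\<close> maps the ball of radius \<open>r\<close> into itself.\<close>
  define r where "r = 1 - sqrt (1 - norm B)"
  have r: "0 \<le> r" "r < 1" using B by (simp_all add: r_def)
  have r2: "norm B + r\<^sup>2 = 2 * r"
    using B by (simp add: r_def power2_diff)
  define F where "F Y = (1/2) *\<^sub>R (B + Y * Y)" for Y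
  define s where "s = {T :: 'a bop. selfadjoint_bop T} \<inter> {T. norm T \<le> r}"
  have "closed {T :: 'a bop. norm T \<le> r}"
    by (intro closed_Collect_le continuous_intros)
  then have "complete s"
    unfolding s_def complete_eq_closed by (intro closed_Int closed_selfadjoint_bop)
  moreover have "0 \<in> s" using r by (simp add: s_def selfadjoint_bop_def)
  then have "s \<noteq> {}" by blast
  moreover have "F ` s \<subseteq> s"
  proof safe
    fix Y assume Y: "Y \<in> s"
    have "norm (F Y) \<le> (norm B + norm Y * norm Y) / 2"
      unfolding F_def using norm_triangle_ineq[of B "Y * Y"] norm_mult_ineq[of Y Y] by simp
    also have "\<dots> \<le> (norm B + r * r) / 2"
      using Y r by (simp add: s_def mult_mono)
    also have "\<dots> = r" using r2 by (simp add: power2_eq_square)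
    finally show "F Y \<in> s"
      using Y B by (simp add: s_def F_def selfadjoint_bop_def inner_add_left inner_add_right)
  qed
  moreover have "dist (F Y) (F Z) \<le> r * dist Y Z" if "Y \<in> s" "Z \<in> s" for Y Z
  proof -
    \<comment> \<open>This splitting of \<open>Y * Y - Z * Z\<close> is valid for noncommuting
      factors; each half contributes \<open>r / 2\<close> to the contraction constant.\<close>
    have "F Y - F Z = (1/2) *\<^sub>R (Y * (Y - Z) + (Y - Z) * Z)"
      by (simp add: F_def algebra_simps)
    then have "norm (F Y - F Z) \<le> (norm (Y * (Y - Z)) + norm ((Y - Z) * Z)) / 2"
      using norm_triangle_ineq[of "Y * (Y - Z)" "(Y - Z) * Z"] by simp
    also have "\<dots> \<le> (norm Y * norm (Y - Z) + norm (Y - Z) * norm Z) / 2"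
      by (intro divide_right_mono add_mono norm_mult_ineq) simp
    also have "\<dots> \<le> (r * norm (Y - Z) + norm (Y - Z) * r) / 2"
      using that by (intro divide_right_mono add_mono mult_left_mono mult_right_mono)
        (auto simp: s_def)
    finally show ?thesis by (simp add: dist_norm)
  qed
  ultimately obtain Y where Y: "Y \<in> s" "F Y = Y"
    using Banach_fix[of s r F] r by blast
  have "2 *\<^sub>R Y = B + Y * Y"
    using arg_cong[OF Y(2), of "scaleR 2"] by (simp add: F_def)
  then have "B = Y + Y - Y * Y" by (simp add: scaleR_2 eq_diff_eq)
  then have "(1 - Y)\<^sup>2 = 1 - B"
    by (simp add: power2_eq_square left_diff_distrib right_diff_distrib)
  moreover have "selfadjoint_bop Y" "norm Y \<le> 1" using Y r by (auto simp: s_def)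
  ultimately show thesis using that by blast
qed

text \<open>As \<open>sqrt_bop\<close> is a choice, it is enough to exhibit one positive square root
  of \<open>A = adj T * T\<close>. Invertibility bounds \<open>T\<close> from below, so
  \<open>B = 1 - A / c\<close> has norm below 1 for large \<open>c\<close>, and
  \<open>sqrt_one_minus\<close> applies.\<close>

lemma modulus_square:
  fixes T :: "'a::chilbert_space bop"
  assumes "invertible_bop T"
  shows "(modulus T)\<^sup>2 = adj T * T"
proof -
  obtain U where U: "U * T = 1" using assms by (auto simp: invertible_bop_def)
  define A where "A = adj T * T"
  have A: "inner (A *\<^sub>V x) y = inner (T *\<^sub>V x) (T *\<^sub>V y)" for x y
    by (simp add: A_def inner_eq_Re_cinner cinner_adj_left)
  \<comment> \<open>Large enough for \<open>(norm (A x))^2 \<le> c * (norm (T x))^2\<close>. The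
    added 1, here and in \<open>e\<close>, avoids division by zero on the trivial space.\<close>
  define c where "c = (norm (adj T))\<^sup>2 + 1"
  have c: "c > 0" by (simp add: c_def add_nonneg_pos)
  define e where "e = 1 / ((norm U)\<^sup>2 + 1) / c"
  have u: "(norm U)\<^sup>2 + 1 > 0" by (simp add: add_nonneg_pos)
  have e: "e > 0" using c u by (simp add: e_def)
  define B where "B = 1 - (1/c) *\<^sub>R A"
  \<comment> \<open>The minimum with 1 keeps the radicand nonnegative.\<close>
  have "norm B \<le> sqrt (1 - min e 1)"
  proof (rule norm_bop_bound)
    fix x
    have "norm (A *\<^sub>V x) \<le> norm (adj T) * norm (T *\<^sub>V x)"
      using norm_bop_apply[of "adj T" "T *\<^sub>V x"] by (simp add: A_def)
    then have "(norm (A *\<^sub>V x))\<^sup>2 \<le> (norm (adj T) * norm (T *\<^sub>V x))\<^sup>2"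
      by (rule power_mono) simp
    also have "\<dots> \<le> c * (norm (T *\<^sub>V x))\<^sup>2"
      by (simp add: c_def power_mult_distrib mult_right_mono)
    finally have Ax: "(norm (A *\<^sub>V x))\<^sup>2 \<le> c * (norm (T *\<^sub>V x))\<^sup>2" .
    have "norm x \<le> norm U * norm (T *\<^sub>V x)"
      using norm_bop_apply[of U "T *\<^sub>V x"] U bop_apply_mult(2)[of U T x] by simp
    then have "(norm x)\<^sup>2 \<le> (norm U * norm (T *\<^sub>V x))\<^sup>2"
      by (rule power_mono) simp
    also have "\<dots> \<le> ((norm U)\<^sup>2 + 1) * (norm (T *\<^sub>V x))\<^sup>2"
      by (simp add: power_mult_distrib mult_right_mono)
    finally have "(norm x)\<^sup>2 / ((norm U)\<^sup>2 + 1) \<le> (norm (T *\<^sub>V x))\<^sup>2"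
      using u by (simp add: pos_divide_le_eq mult.commute)
    from divide_right_mono[OF this, of c] c
    have Tx: "e * (norm x)\<^sup>2 \<le> (norm (T *\<^sub>V x))\<^sup>2 / c"
      by (simp add: e_def)
    have "(norm (B *\<^sub>V x))\<^sup>2 = (norm x)\<^sup>2 - 2 / c * (norm (T *\<^sub>V x))\<^sup>2 + (norm (A *\<^sub>V x))\<^sup>2 / c\<^sup>2"
      unfolding power2_norm_eq_inner A[of x x, symmetric]
      by (simp add: B_def inner_diff_left inner_diff_right
          inner_commute[of x "A *\<^sub>V x"] power2_eq_square[of c]
          diff_divide_distrib)
    also have "(norm (A *\<^sub>V x))\<^sup>2 / c\<^sup>2 \<le> c * (norm (T *\<^sub>V x))\<^sup>2 / c\<^sup>2"
      by (rule divide_right_mono[OF Ax]) simp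
    also have "\<dots> = (norm (T *\<^sub>V x))\<^sup>2 / c" using c by (simp add: power2_eq_square)
    finally have "(norm (B *\<^sub>V x))\<^sup>2 \<le> (norm x)\<^sup>2 - (norm (T *\<^sub>V x))\<^sup>2 / c" by simp
    also have "\<dots> \<le> (norm x)\<^sup>2 - e * (norm x)\<^sup>2" using Tx by simp
    also have "\<dots> \<le> (1 - min e 1) * (norm x)\<^sup>2"
      by (simp add: left_diff_distrib mult_right_mono)
    also have "\<dots> = (sqrt (1 - min e 1) * norm x)\<^sup>2"
      by (simp add: power_mult_distrib)
    finally show "norm (B *\<^sub>V x) \<le> sqrt (1 - min e 1) * norm x"
      by (rule power2_le_imp_le) simp
  qed simp
  also have "\<dots> < 1" using e by simp
  finally have "norm B < 1" .
  moreover have "selfadjoint_bop B"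
    using A by (simp add: selfadjoint_bop_def B_def inner_diff_left inner_diff_right
        inner_commute[of _ "A *\<^sub>V _"])
      (simp add: inner_commute)
  ultimately obtain Y where Y: "selfadjoint_bop Y" "norm Y \<le> 1" "(1 - Y)\<^sup>2 = 1 - B"
    using sqrt_one_minus by blast
  define R where "R = sqrt c *\<^sub>R (1 - Y)"
  have "R\<^sup>2 = c *\<^sub>R (1 - Y)\<^sup>2"
    using c by (simp add: R_def power2_eq_square)
  then have RA: "R\<^sup>2 = A" using c by (simp add: Y(3) B_def)
  have "positive_bop R"
    unfolding positive_bop_def
  proof
    fix x
    have "selfadjoint_bop R"
      using Y(1) by (simp add: R_def selfadjoint_bop_def inner_diff_left inner_diff_right)
    then have real: "cinner (R *\<^sub>V x) x \<in> \<real>" by (rule selfadjoint_bop_in_Reals)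
    have "inner (Y *\<^sub>V x) x \<le> norm (Y *\<^sub>V x) * norm x" by (rule norm_cauchy_schwarz)
    also have "\<dots> \<le> (1 * norm x) * norm x"
      by (intro mult_right_mono order.trans[OF norm_bop_apply] Y(2)) simp_all
    finally have "0 \<le> inner (R *\<^sub>V x) x"
      using c by (simp add: R_def inner_diff_left dot_square_norm power2_eq_square)
    then show "cinner (R *\<^sub>V x) x \<in> \<real>\<^sub>\<ge>\<^sub>0"
      using real by (simp add: complex_nonneg_Reals_iff inner_eq_Re_cinner complex_is_Real_iff)
  qed
  with RA show ?thesis
    unfolding modulus_def sqrt_bop_def A_def[symmetric]
    using someI[of "\<lambda>R. positive_bop R \<and> R\<^sup>2 = A" R] by blast
qed

section \<open>Finite differences and operator polynomials\<close>

lemma scaleC_zero_left [simp]: "0 *\<^sub>C x = (0 :: 'a::complex_vector)"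
  using scaleC_add_left[of 0 0 x] by simp

lemma scaleC_minus_left: "(- c) *\<^sub>C x = - (c *\<^sub>C x)" for x :: "'a::complex_vector"
  using scaleC_add_left[of c "- c" x] by (simp add: eq_neg_iff_add_eq_0 add.commute)

lemma scaleC_diff_left: "(c - d) *\<^sub>C x = c *\<^sub>C x - d *\<^sub>C x" for x :: "'a::complex_vector"
  using scaleC_add_left[of c "- d" x] by (simp add: scaleC_minus_left)

lemma scaleC_sum_left: "(\<Sum>i\<in>I. f i) *\<^sub>C x = (\<Sum>i\<in>I. f i *\<^sub>C x)"
  for x :: "'a::complex_vector"
  by (induction I rule: infinite_finite_induct) (simp_all add: scaleC_add_left)

lemma scaleC_sum_right: "c *\<^sub>C (\<Sum>i\<in>I. f i) = (\<Sum>i\<in>I. c *\<^sub>C f i)"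
  for f :: "'b \<Rightarrow> 'a::complex_vector"
  by (induction I rule: infinite_finite_induct) (simp_all add: scaleC_add_right)

text \<open>The \<open>m\<close>-th forward difference with step 1, kept expanded because these are
  the coefficients in \<open>m_isometric\<close>.\<close>

definition fdiff :: "nat \<Rightarrow> (int \<Rightarrow> 'v::real_vector) \<Rightarrow> int \<Rightarrow> 'v"
  where "fdiff m a i = (\<Sum>k\<le>m. (real (m choose k) * (- 1) ^ (m - k)) *\<^sub>R a (i + int k))"

lemma fdiff_0 [simp]: "fdiff 0 a i = a i"
  by (simp add: fdiff_def)

text \<open>Pascal's rule splits the sum in two; one half, together with the term at
  \<open>k = 0\<close>, is minus the \<open>m\<close>-th difference of \<open>a\<close>.\<close>

lemma fdiff_Suc: "fdiff (Suc m) a i = fdiff m (\<lambda>i. a (i + 1) - a i) i"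
proof -
  let ?c = "\<lambda>k. real (m choose k)" and ?f = "\<lambda>k. a (i + int k)"
  have "fdiff (Suc m) a i = (- 1) ^ Suc m *\<^sub>R ?f 0
      + (\<Sum>k\<le>m. (?c (Suc k) * (- 1) ^ (m - k)) *\<^sub>R ?f (Suc k))
      + (\<Sum>k\<le>m. (?c k * (- 1) ^ (m - k)) *\<^sub>R ?f (Suc k))"
    unfolding fdiff_def sum.atMost_Suc_shift
    by (simp add: sum.distrib[symmetric] distrib_right scaleR_add_left add.commute)
  also have "(- 1) ^ Suc m *\<^sub>R ?f 0 + (\<Sum>k\<le>m. (?c (Suc k) * (- 1) ^ (m - k)) *\<^sub>R ?f (Suc k))
      = (\<Sum>k\<le>Suc m. (?c k * (- 1) ^ (Suc m - k)) *\<^sub>R ?f k)"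
    unfolding sum.atMost_Suc_shift by simp
  also have "\<dots> = (\<Sum>k\<le>m. (?c k * (- 1) ^ (Suc m - k)) *\<^sub>R ?f k)"
    by (simp add: binomial_eq_0)
  also have "\<dots> = - (\<Sum>k\<le>m. (?c k * (- 1) ^ (m - k)) *\<^sub>R ?f k)"
    unfolding sum_negf[symmetric] by (rule sum.cong) (auto simp: Suc_diff_le)
  finally show ?thesis
    by (simp add: fdiff_def scaleR_diff_right sum_subtractf add_ac)
qed

text \<open>Newton interpolation: the induction hypothesis expands the first difference of
  \<open>a\<close>, and summation raises every lower binomial index by one. The complex
  \<open>gchoose\<close> lets the formula be read later as a polynomial in a complex
  variable.\<close>

lemma fdiff_eq_0_imp_newton:
  fixes a :: "int \<Rightarrow> 'v::complex_vector"
  assumes "\<And>i. fdiff m a i = 0"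
  shows "\<exists>B. \<forall>n. a n = (\<Sum>j<m. (complex_of_int n gchoose j) *\<^sub>C B j)"
  using assms
proof (induction m arbitrary: a)
  case 0
  then show ?case by simp
next
  case (Suc m)
  from Suc.IH[of "\<lambda>i. a (i + 1) - a i"] Suc.prems obtain B
    where B: "a (n + 1) - a n = (\<Sum>j<m. (complex_of_int n gchoose j) *\<^sub>C B j)" for n
    by (auto simp: fdiff_Suc)
  \<comment> \<open>The constant of summation \<open>a 0\<close> comes first; the old coefficients
    move up one place.\<close>
  define B' where "B' j = (case j of 0 \<Rightarrow> a 0 | Suc j \<Rightarrow> B j)" for j
  define q where "q n = (\<Sum>j<Suc m. (complex_of_int n gchoose j) *\<^sub>C B' j)" for n
  have q_Suc: "q n = a 0 + (\<Sum>j<m. (complex_of_int n gchoose Suc j) *\<^sub>C B j)" for n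
    unfolding q_def sum.lessThan_Suc_shift by (simp add: B'_def)
  have step: "q (n + 1) - q n = a (n + 1) - a n" for n
    by (simp add: q_Suc B gbinomial_Suc_Suc scaleC_add_left sum.distrib)
  have "a n = q n" for n
  \<comment> \<open>Equal first differences and equal values at 0 propagate in both
    directions.\<close>
  proof (induction n rule: int_induct[where k = 0])
    case base
    show ?case by (simp add: q_Suc)
  next
    case (step1 n)
    then show ?case using step[of n] by simp
  next
    case (step2 n)
    then show ?case using step[of "n - 1"] by simp
  qed
  then show ?case unfolding q_def by blast
qed

section \<open>Operator polynomials of bounded degree\<close>

lemma bop_polys_monom: "k \<le> n \<Longrightarrow> (\<lambda>z. z ^ k *\<^sub>C A) \<in> bop_polys n"
  unfolding bop_polys_def
proof (intro CollectI exI allI)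
  fix z assume "k \<le> n"
  then show "z ^ k *\<^sub>C A = (\<Sum>j\<le>n. z ^ j *\<^sub>C (if j = k then A else 0))"
    using sum.remove[of "{..n}" k "\<lambda>j. z ^ j *\<^sub>C (if j = k then A else 0)"] by simp
qed

lemma bop_polys_sum:
  assumes "\<And>i. i \<in> I \<Longrightarrow> f i \<in> bop_polys n"
  shows "(\<lambda>z. \<Sum>i\<in>I. f i z) \<in> bop_polys n"
proof -
  obtain A where "\<And>i z. i \<in> I \<Longrightarrow> f i z = (\<Sum>j\<le>n. z ^ j *\<^sub>C A i j)"
    using assms unfolding bop_polys_def by simp metis
  then have "(\<Sum>i\<in>I. f i z) = (\<Sum>j\<le>n. z ^ j *\<^sub>C (\<Sum>i\<in>I. A i j))" for z
    by (simp add: scaleC_sum_right sum.swap[of _ I])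
  then show ?thesis
    unfolding bop_polys_def by (intro CollectI exI[of _ "\<lambda>j. \<Sum>i\<in>I. A i j"]) simp
qed

lemma bop_polys_add:
  assumes "p \<in> bop_polys n" "q \<in> bop_polys n"
  shows "(\<lambda>z. p z + q z) \<in> bop_polys n"
  using bop_polys_sum[of UNIV "\<lambda>b. if b then p else q" n] assms by (simp add: UNIV_bool add.commute)

lemma bop_polys_mono: "k \<le> n \<Longrightarrow> p \<in> bop_polys k \<Longrightarrow> p \<in> bop_polys n"
proof -
  assume "k \<le> n" "p \<in> bop_polys k"
  then obtain A where "p = (\<lambda>z. \<Sum>j\<le>k. z ^ j *\<^sub>C A j)" by (auto simp: bop_polys_def)
  then show ?thesis
    using \<open>k \<le> n\<close> by (auto intro!: bop_polys_sum bop_polys_monom)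
qed

text \<open>Induction by \<open>(k + 1) * (z gchoose (k + 1)) = (z - k) * (z gchoose k)\<close>: a
  linear factor raises the degree by at most one.\<close>

lemma bop_polys_gbinomial: "(\<lambda>z. (z gchoose k) *\<^sub>C A) \<in> bop_polys k"
proof (induction k)
  case 0
  then show ?case using bop_polys_monom[of 0 0 A] by simp
next
  case (Suc k)
  then obtain C where C: "\<And>z. (z gchoose k) *\<^sub>C A = (\<Sum>j\<le>k. z ^ j *\<^sub>C C j)"
    by (auto simp: bop_polys_def)
  let ?b = "\<lambda>z. \<Sum>j\<le>k. z ^ Suc j *\<^sub>C ((1 / of_nat (Suc k)) *\<^sub>C C j)
    + z ^ j *\<^sub>C ((- of_nat k / of_nat (Suc k)) *\<^sub>C C j)"
  have "(z gchoose Suc k) *\<^sub>C A = ?b z" for z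
  proof -
    have "(z gchoose Suc k) *\<^sub>C A = ((z - of_nat k) / of_nat (Suc k)) *\<^sub>C (z gchoose k) *\<^sub>C A"
      using gbinomial_mult_1[of z k] by (simp add: field_simps del: of_nat_Suc)
    also have "\<dots> = ?b z"
      unfolding C scaleC_sum_right
      by (rule sum.cong) (simp_all add: scaleC_add_left[symmetric] diff_divide_distrib
          algebra_simps del: of_nat_Suc)
    finally show ?thesis .
  qed
  moreover have "?b \<in> bop_polys (Suc k)"
    unfolding sum.distrib
    by (intro bop_polys_add bop_polys_sum bop_polys_monom) auto
  ultimately show ?case by simp
qed

text \<open>The leading power cancels in \<open>(z + 1) ^ j - z ^ j\<close>, by the binomial
  theorem.\<close>

lemma bop_polys_diff:
  assumes "p \<in> bop_polys (Suc n)"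
  shows "(\<lambda>z. p (z + 1) - p z) \<in> bop_polys n"
proof -
  obtain A where A: "\<And>z. p z = (\<Sum>j\<le>Suc n. z ^ j *\<^sub>C A j)"
    using assms by (auto simp: bop_polys_def)
  have "p (z + 1) - p z = (\<Sum>j\<le>Suc n. \<Sum>k<j. z ^ k *\<^sub>C (of_nat (j choose k) *\<^sub>C A j))" for z
  proof -
    have "(z + 1) ^ j - z ^ j = (\<Sum>k<j. z ^ k * of_nat (j choose k))" for j
      by (simp add: binomial_ring lessThan_Suc_atMost[symmetric] mult.commute)
    then show ?thesis
      unfolding A sum_subtractf[symmetric] scaleC_diff_left[symmetric]
      by (simp only: scaleC_sum_left scaleC_scaleC)
  qed
  then have "(\<lambda>z. p (z + 1) - p z)
      = (\<lambda>z. \<Sum>j\<le>Suc n. \<Sum>k<j. z ^ k *\<^sub>C (of_nat (j choose k) *\<^sub>C A j))" by blast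
  also have "\<dots> \<in> bop_polys n"
    by (intro bop_polys_sum bop_polys_monom) auto
  finally show ?thesis .
qed

lemma fdiff_bop_polys:
  assumes "p \<in> bop_polys n"
  shows "fdiff (Suc n) (\<lambda>i. p (of_int i)) i = 0"
  using assms
proof (induction n arbitrary: p)
  case 0
  then show ?case by (auto simp: bop_polys_def fdiff_Suc)
next
  case (Suc n)
  show ?case
    using Suc.IH[OF bop_polys_diff[OF Suc.prems]] by (subst fdiff_Suc) simp
qed

section \<open>Bilateral weighted shifts\<close>

lemma bop_apply_zero_right [simp]: "T *\<^sub>V 0 = 0"
  using bop_apply_scaleR_right[of T 0 0] by simp

lemma bop_apply_sum: "(\<Sum>i\<in>I. T i) *\<^sub>V x = (\<Sum>i\<in>I. T i *\<^sub>V x)"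
  by (induction I rule: infinite_finite_induct) simp_all

lemma inverse_bop_eqI: "T * U = 1 \<Longrightarrow> U * T = 1 \<Longrightarrow> inverse_bop T = U"
  unfolding inverse_bop_def
proof (rule the_equality)
  fix V assume "T * U = 1" "U * T = 1" "T * V = 1 \<and> V * T = 1"
  then show "V = U" by (metis mult.assoc mult_1_left mult_1_right)
qed simp

lemma inverse_bop_inverse:
  assumes "invertible_bop T"
  shows "T * inverse_bop T = 1" "inverse_bop T * T = 1"
proof -
  obtain U where "T * U = 1" "U * T = 1" using assms by (auto simp: invertible_bop_def)
  then show "T * inverse_bop T = 1" "inverse_bop T * T = 1" by (simp_all add: inverse_bop_eqI)
qed

lemma invertible_bop_one: "invertible_bop 1"
  by (auto simp: invertible_bop_def intro!: exI[of _ 1])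

lemma inverse_bop_one [simp]: "inverse_bop 1 = 1"
  by (rule inverse_bop_eqI) simp_all

lemma mult_cancel_middle:
  fixes T U V X :: "'a::monoid_mult"
  shows "U * V = 1 \<Longrightarrow> T * U * (V * X) = T * X"
  by (metis mult.assoc mult_1_left)

lemma invertible_bop_mult:
  assumes "invertible_bop T" "invertible_bop U"
  shows "invertible_bop (T * U)" "inverse_bop (T * U) = inverse_bop U * inverse_bop T"
proof -
  have *: "T * U * (inverse_bop U * inverse_bop T) = 1"
    "inverse_bop U * inverse_bop T * (T * U) = 1"
    by (simp_all add: mult_cancel_middle inverse_bop_inverse assms)
  then show "invertible_bop (T * U)" "inverse_bop (T * U) = inverse_bop U * inverse_bop T"
    by (auto simp: invertible_bop_def intro: inverse_bop_eqI)
qed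

lemma invertible_bop_adj:
  fixes T :: "'a::chilbert_space bop"
  assumes "invertible_bop T"
  shows "invertible_bop (adj T)" "inverse_bop (adj T) = adj (inverse_bop T)"
proof -
  have *: "adj T * adj (inverse_bop T) = 1" "adj (inverse_bop T) * adj T = 1"
    by (simp_all add: adj_mult[symmetric] inverse_bop_inverse assms)
  then show "invertible_bop (adj T)" "inverse_bop (adj T) = adj (inverse_bop T)"
    by (auto simp: invertible_bop_def intro: inverse_bop_eqI)
qed

lemma invertible_bop_apply_eq_0:
  assumes "invertible_bop T" "T *\<^sub>V x = 0"
  shows "x = 0"
proof -
  have "x = (inverse_bop T * T) *\<^sub>V x" by (simp only: inverse_bop_inverse assms bop_apply_mult)
  then show ?thesis using assms(2) by simp
qed

lemma adj_power: "adj T ^ k = adj (T ^ k)"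
proof (induction k)
  case (Suc k)
  have "adj T ^ Suc k = adj T ^ k * adj T" by (rule power_Suc2)
  then show ?case by (simp add: Suc adj_mult)
qed simp

section \<open>Sequences supported at one index\<close>

lemma infsum_single:
  fixes f :: "'b \<Rightarrow> 'c::{topological_comm_monoid_add, t2_space}"
  assumes "\<And>j. j \<noteq> i \<Longrightarrow> f j = 0"
  shows "infsum f UNIV = f i"
proof -
  have "infsum f UNIV = infsum f {i}"
    by (rule infsum_cong_neutral) (auto simp: assms)
  then show ?thesis by simp
qed

lift_definition ell2_single :: "int \<Rightarrow> 'a::complex_inner \<Rightarrow> 'a ell2"
  is "\<lambda>i x j. if j = i then x else 0"
proof -
  fix i :: int and x :: 'a
  have "(\<lambda>j. (norm (if j = i then x else 0))\<^sup>2) summable_on {i}" by simp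
  then show "(\<lambda>j. (norm (if j = i then x else 0))\<^sup>2) summable_on UNIV"
    by (rule summable_on_cong_neutral[THEN iffD1, rotated -1]) auto
qed

lemma coord_single: "coord (ell2_single i x) j = (if j = i then x else 0)"
  by (simp add: ell2_single.rep_eq)

lemma norm_ell2_single: "norm (ell2_single i x) = norm x"
proof -
  have "(norm (ell2_single i x))\<^sup>2 = (norm x)\<^sup>2"
    unfolding norm_ell2_square by (subst infsum_single[of i]) (auto simp: coord_single)
  then show ?thesis by simp
qed

text \<open>Pairing with such sequences reads off coordinates, which is how the adjoint of the shift
  is computed.\<close>

lemma cinner_ell2_single: "cinner (ell2_single i x) f = cinner x (coord f i)"
proof -
  have z: "cinner 0 y = 0" for y :: 'a
    using cinner_add_left[of 0 0 y] by simp
  show ?thesis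
    unfolding cinner_ell2_def by (subst infsum_single[of i]) (auto simp: coord_single z)
qed

lemma coord_zero: "coord 0 i = 0"
  by (simp add: zero_ell2.rep_eq)

lemma coord_scaleR: "coord (r *\<^sub>R f) i = r *\<^sub>R coord f i"
  by (simp add: scaleR_ell2.rep_eq)

lemma coord_sum: "coord (\<Sum>k\<in>I. f k) i = (\<Sum>k\<in>I. coord (f k) i)"
  by (induction I rule: infinite_finite_induct) (simp_all add: coord_zero plus_ell2.rep_eq)

text \<open>The product \<open>W (i + k) * ... * W (i + 1)\<close>, by which the \<open>k\<close>-th
  power of the shift carries coordinate \<open>i\<close> to coordinate \<open>i + k\<close>.\<close>

primrec window :: "(int \<Rightarrow> 'a::monoid_mult) \<Rightarrow> int \<Rightarrow> nat \<Rightarrow> 'a"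
  where
    "window W i 0 = 1"
  | "window W i (Suc k) = W (i + int (Suc k)) * window W i k"

text \<open>Peels off the rightmost factor, as needed when a window is extended to the left.\<close>

lemma window_Suc_right: "window W i (Suc k) = window W (i + 1) k * W (i + 1)"
  by (induction k) (simp_all add: mult.assoc add_ac)

lemma window_eq_prod_list: "window W i k = (\<Prod>j\<leftarrow>rev [i + 1..i + int k]. W j)"
proof (induction k)
  case (Suc k)
  have "[i + 1..i + int (Suc k)] = [i + 1..i + int k] @ [i + int (Suc k)]"
    using upto_rec2[of "i + 1" "i + int (Suc k)"] by (simp add: add_ac)
  then show ?case using Suc by simp
qed simp

text \<open>The adjoint reverses products, so an increasing product of adjoints is the adjoint of a
  decreasing product, hence of a window.\<close>

lemma prod_list_adj: "(\<Prod>j\<leftarrow>xs. adj (W j)) = adj (\<Prod>j\<leftarrow>rev xs. W j)"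
proof -
  have "adj (prod_list ys) = prod_list (rev (map adj ys))" for ys :: "'a bop list"
    by (induction ys) (simp_all add: adj_mult)
  then show ?thesis by (simp add: rev_map comp_def)
qed

section \<open>Interpolation conditions for invertible weights\<close>

locale invertible_weights =
  fixes W :: "int \<Rightarrow> 'a::chilbert_space bop"
  assumes invertible_W: "invertible_bop (W i)"
begin

lemma invertible_window: "invertible_bop (window W i k)"
  by (induction k) (auto intro: invertible_bop_one invertible_bop_mult invertible_W)

text \<open>The two-sided solution of \<open>Q n = W n * Q (n - 1)\<close> with \<open>Q 0 = 1\<close>.\<close>

definition Q :: "int \<Rightarrow> 'a bop"
  where "Q n = (if 0 \<le> n then window W 0 (nat n) else inverse_bop (window W n (nat (- n))))"

lemma Q_nonneg: "Q (int n) = window W 0 n"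
  by (simp add: Q_def)

lemma Q_neg: "Q (- int n) = inverse_bop (window W (- int n) n)"
  by (cases "n = 0") (simp_all add: Q_def)

lemma invertible_Q: "invertible_bop (Q n)"
proof -
  have "invertible_bop (inverse_bop (window W i k))" for i k
    unfolding invertible_bop_def using inverse_bop_inverse[OF invertible_window] by blast
  then show ?thesis by (simp add: Q_def invertible_window)
qed

text \<open>For \<open>n \<le> 0\<close> the window of \<open>Q (n - 1)\<close> has the extra
  rightmost factor \<open>W n\<close>, so its inverse is
  \<open>inverse_bop (W n) * Q n\<close>.\<close>

lemma Q_step: "Q n = W n * Q (n - 1)"
proof (cases "0 < n")
  case True
  then obtain k where "n = int (Suc k)" by (metis pos_int_cases Suc_pred)
  then show ?thesis using Q_nonneg[of "Suc k"] Q_nonneg[of k] by simp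
next
  case False
  then obtain k where k: "n = - int k" by (metis nonpos_int_cases linorder_not_less)
  have "Q (n - 1) = inverse_bop (window W n k * W n)"
  proof -
    have "n - 1 = - int (Suc k)" using k by simp
    then have "Q (n - 1) = inverse_bop (window W (n - 1) (Suc k))" by (simp only: Q_neg)
    then show ?thesis by (simp add: window_Suc_right del: window.simps)
  qed
  also have "\<dots> = inverse_bop (W n) * Q n"
    by (simp add: invertible_bop_mult invertible_window invertible_W k Q_neg)
  finally show ?thesis
    using inverse_bop_inverse[OF invertible_W[of n]] by (simp add: mult.assoc[symmetric])
qed

text \<open>Iterates \<open>Q_step\<close> from \<open>i\<close>, across 0 if need be; all windows
  are thereby expressed through the single sequence \<open>Q\<close>.\<close>

lemma window_mult_Q: "window W i k * Q i = Q (i + int k)"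
proof (induction k)
  case (Suc k)
  then show ?case using Q_step[of "i + int (Suc k)"] by (simp add: mult.assoc add_ac)
qed simp

text \<open>The sequence \<open>a\<close> of the opening sketch.\<close>

definition gram :: "int \<Rightarrow> 'a bop"
  where "gram n = adj (Q n) * Q n"

lemma cinner_gram: "cinner (gram n *\<^sub>V h) h = complex_of_real ((norm (Q n *\<^sub>V h))\<^sup>2)"
  by (simp add: gram_def cinner_adj_left cinner_self)

text \<open>In \<open>Q (i + k) = window W i k * Q i\<close> the factor \<open>Q i\<close> does not
  depend on \<open>k\<close>, so it leaves the sum on both sides.\<close>

lemma fdiff_gram:
  "fdiff m gram i = adj (Q i) *
    (\<Sum>k\<le>m. (real (m choose k) * (- 1) ^ (m - k)) *\<^sub>R (adj (window W i k) * window W i k)) * Q i"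
proof -
  have "gram (i + int k) = adj (Q i) * (adj (window W i k) * window W i k) * Q i" for k
    by (simp add: gram_def window_mult_Q[symmetric] adj_mult mult.assoc)
  then show ?thesis
    by (simp add: fdiff_def sum_distrib_left sum_distrib_right)
qed

lemma interpolates_weights_iff:
  "interpolates_weights W p \<longleftrightarrow> (\<forall>n. p (of_int n) = gram n)"
proof -
  have pos: "(modulus (\<Prod>i\<leftarrow>rev [1..int n]. W i))\<^sup>2 = gram (int n)" for n
  proof -
    have "(\<Prod>i\<leftarrow>rev [1..int n]. W i) = Q (int n)"
      using window_eq_prod_list[of W 0 n] by (simp add: Q_nonneg)
    then show ?thesis by (simp only: modulus_square invertible_Q gram_def)
  qed
  \<comment> \<open>With \<open>P\<close> the window, the product is \<open>adj P\<close>, its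
    squared modulus is \<open>P * adj P\<close>, and the inverse of that is
    \<open>adj (Q (- n)) * Q (- n)\<close> since \<open>Q (- n)\<close> is the inverse of
    \<open>P\<close>.\<close>
  have neg: "inverse_bop ((modulus (\<Prod>i\<leftarrow>[- int n + 1..0]. adj (W i)))\<^sup>2) = gram (- int n)" for n
  proof -
    let ?P = "window W (- int n) n"
    have "(\<Prod>i\<leftarrow>[- int n + 1..0]. adj (W i)) = adj ?P"
      using window_eq_prod_list[of W "- int n" n] by (simp add: prod_list_adj)
    then show ?thesis
      by (simp add: modulus_square invertible_window invertible_bop_adj invertible_bop_mult
          gram_def Q_neg)
  qed
  have zero: "gram 0 = 1" using Q_nonneg[of 0] by (simp add: gram_def)
  show ?thesis
  proof
    assume p: "interpolates_weights W p"
    show "\<forall>n. p (of_int n) = gram n"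
    proof
      fix n :: int
      consider "n = 0" | k where "n = int k" "1 \<le> int k" | k where "n = - int k" "1 \<le> int k"
        by (cases n rule: int_cases2) force+
      then show "p (of_int n) = gram n"
      proof cases
        case 1
        then show ?thesis using p by (simp add: interpolates_weights_def zero)
      next
        case 2
        then have "p (of_int n) = (modulus (\<Prod>i\<leftarrow>rev [1..n]. W i))\<^sup>2"
          using p unfolding interpolates_weights_def by blast
        then show ?thesis by (simp only: 2 pos)
      next
        case 3
        then have "p (of_int (- int k)) = inverse_bop ((modulus (\<Prod>i\<leftarrow>[- int k + 1..0]. adj (W i)))\<^sup>2)"
          using p unfolding interpolates_weights_def by blast
        then show ?thesis by (simp only: 3 neg)
      qed
    qed
  next
    assume p: "\<forall>n. p (of_int n) = gram n"
    show "interpolates_weights W p"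
      unfolding interpolates_weights_def
    proof (intro conjI allI impI)
      show "p 0 = 1" using p[rule_format, of 0] zero by simp
      fix n :: int assume "1 \<le> n"
      then obtain k where "n = int k" by (metis nonneg_int_cases order_trans zero_le_one)
      then show "p (of_int n) = (modulus (\<Prod>i\<leftarrow>rev [1..n]. W i))\<^sup>2"
        "p (of_int (- n)) = inverse_bop ((modulus (\<Prod>i\<leftarrow>[- n + 1..0]. adj (W i)))\<^sup>2)"
        using p by (simp_all only: pos neg)
    qed
  qed
qed

text \<open>A polynomial of degree below \<open>m\<close> has vanishing \<open>m\<close>-th
  differences; conversely the Newton expansion of \<open>gram\<close> extends to complex arguments
  with degree at most \<open>m - 1\<close>.\<close>

lemma ex_interpolating_poly_iff:
  assumes "1 \<le> m"
  shows "(\<exists>p\<in>bop_polys (m - 1). interpolates_weights W p) \<longleftrightarrow> (\<forall>i. fdiff m gram i = 0)"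
proof
  assume "\<exists>p\<in>bop_polys (m - 1). interpolates_weights W p"
  then obtain p where p: "p \<in> bop_polys (m - 1)" "\<And>n. gram n = p (of_int n)"
    by (auto simp: interpolates_weights_iff)
  then show "\<forall>i. fdiff m gram i = 0"
    using fdiff_bop_polys[OF p(1)] assms p(2)[abs_def] by simp
next
  assume "\<forall>i. fdiff m gram i = 0"
  then obtain B where B: "\<And>n. gram n = (\<Sum>j<m. (complex_of_int n gchoose j) *\<^sub>C B j)"
    using fdiff_eq_0_imp_newton[of m gram] by blast
  have "(\<lambda>z. \<Sum>j<m. (z gchoose j) *\<^sub>C B j) \<in> bop_polys (m - 1)"
    using assms by (intro bop_polys_sum) (auto intro!: bop_polys_mono[OF _ bop_polys_gbinomial])
  then show "\<exists>p\<in>bop_polys (m - 1). interpolates_weights W p"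
    by (rule rev_bexI) (simp add: interpolates_weights_iff B)
qed

end

section \<open>The shift operator: isometry condition and norm\<close>

locale invertible_shift = invertible_weights +
  fixes S :: "'a ell2 bop"
  assumes shift: "bilateral_weighted_shift W S"
begin

lemma coord_shift: "coord (S *\<^sub>V f) i = W i *\<^sub>V coord f (i - 1)"
  using shift by (simp add: bilateral_weighted_shift_def)

lemma coord_shift_power: "coord (S ^ k *\<^sub>V f) (i + int k) = window W i k *\<^sub>V coord f i"
proof (induction k)
  case (Suc k)
  then show ?case by (simp add: coord_shift)
qed simp

lemma shift_power_single: "S ^ k *\<^sub>V ell2_single i x = ell2_single (i + int k) (window W i k *\<^sub>V x)"
proof (rule ell2_eqI)
  fix j
  show "coord (S ^ k *\<^sub>V ell2_single i x) j = coord (ell2_single (i + int k) (window W i k *\<^sub>V x)) j"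
    using coord_shift_power[of k "ell2_single i x" "j - int k"] by (auto simp: coord_single)
qed

text \<open>Tested against a vector at index \<open>i\<close>, which the \<open>k\<close>-th power
  of \<open>S\<close> sends to index \<open>i + k\<close>.\<close>

lemma coord_adj_shift_power:
  "coord (adj S ^ k *\<^sub>V f) i = adj (window W i k) *\<^sub>V coord f (i + int k)"
proof (rule cinner_extensionality)
  fix x
  have "cinner x (coord (adj S ^ k *\<^sub>V f) i) = cinner (S ^ k *\<^sub>V ell2_single i x) f"
    by (simp add: cinner_ell2_single[symmetric] cinner_adj_right adj_power)
  also have "\<dots> = cinner x (adj (window W i k) *\<^sub>V coord f (i + int k))"
    by (simp add: shift_power_single cinner_ell2_single cinner_adj_right)
  finally show "cinner x (coord (adj S ^ k *\<^sub>V f) i) = \<dots>" .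
qed

text \<open>Each \<open>adj S ^ k * S ^ k\<close> preserves every coordinate, so the defining sum
  \<open>X\<close> is diagonal with entries \<open>D i\<close>, and \<open>fdiff_gram\<close>
  exhibits the differences as congruent to these entries.\<close>

lemma m_isometric_iff: "m_isometric m S \<longleftrightarrow> (\<forall>i. fdiff m gram i = 0)"
proof -
  let ?c = "\<lambda>k. real (m choose k) * (- 1) ^ (m - k)"
  define X where "X = (\<Sum>k\<le>m. ?c k *\<^sub>R (adj S ^ k * S ^ k))"
  define D where
    "D i = (\<Sum>k\<le>m. ?c k *\<^sub>R (adj (window W i k) * window W i k))" for i
  have coordX: "coord (X *\<^sub>V f) i = D i *\<^sub>V coord f i" for f i
    by (simp add: X_def D_def bop_apply_sum coord_sum coord_scaleR
        coord_adj_shift_power coord_shift_power)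
  have "X = 0 \<longleftrightarrow> (\<forall>i. D i = 0)"
  proof
    assume "X = 0"
    show "\<forall>i. D i = 0"
    proof (intro allI bop_eqI)
      fix i x
      show "D i *\<^sub>V x = 0 *\<^sub>V x"
        using coordX[of "ell2_single i x" i] by (simp add: \<open>X = 0\<close> coord_single coord_zero)
    qed
  next
    assume "\<forall>i. D i = 0"
    then show "X = 0" by (intro bop_eqI ell2_eqI) (simp add: coordX coord_zero)
  qed
  moreover have "fdiff m gram i = 0 \<longleftrightarrow> D i = 0" for i
  proof
    assume *: "fdiff m gram i = 0"
    let ?V = "inverse_bop (Q i)"
    have V: "adj ?V * adj (Q i) = 1" "Q i * ?V = 1"
      using inverse_bop_inverse[OF invertible_Q[of i]] by (simp_all add: adj_mult[symmetric])
    \<comment> \<open>Undoes the congruence by inserting two identities.\<close>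
    have "D i = (adj ?V * adj (Q i)) * D i * (Q i * ?V)" by (simp only: V mult_1_left mult_1_right)
    also have "\<dots> = adj ?V * fdiff m gram i * ?V"
      by (simp only: fdiff_gram D_def mult.assoc)
    finally show "D i = 0" by (simp add: *)
  qed (simp add: fdiff_gram D_def)
  ultimately show ?thesis by (simp add: m_isometric_def X_def)
qed

lemma norm_weight_apply: "norm (W i *\<^sub>V y) \<le> norm S * norm y"
proof -
  have "W i *\<^sub>V y = coord (S *\<^sub>V ell2_single (i - 1) y) i"
    by (simp add: coord_shift coord_single)
  also have "norm \<dots> \<le> norm (S *\<^sub>V ell2_single (i - 1) y)" by (rule norm_coord_le)
  also have "\<dots> \<le> norm S * norm y"
    using norm_bop_apply[of S "ell2_single (i - 1) y"] by (simp add: norm_ell2_single)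
  finally show ?thesis .
qed

text \<open>The bound holds coordinatewise and is summed; moving the index by one leaves the sum
  over all integers unchanged.\<close>

lemma norm_shift_le:
  assumes "0 \<le> c" "\<And>i y. (norm (W i *\<^sub>V y))\<^sup>2 \<le> c * (norm y)\<^sup>2"
  shows "(norm S)\<^sup>2 \<le> c"
proof -
  have "norm S \<le> sqrt c"
  proof (rule norm_bop_bound)
    fix f :: "'a ell2"
    have reindex: "bij (\<lambda>i::int. i - 1)"
      by (rule bij_betw_byWitness[where f' = "\<lambda>i. i + 1"]) auto
    have sum: "(\<lambda>i. c * (norm (coord f (i - 1)))\<^sup>2) summable_on UNIV"
      using summable_on_reindex_bij_betw[OF reindex, of "\<lambda>i. (norm (coord f i))\<^sup>2"]
      by (intro summable_on_cmult_right) (simp add: ell2_norm_summable)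
    have "(norm (S *\<^sub>V f))\<^sup>2 \<le> (\<Sum>\<^sub>\<infinity>i. c * (norm (coord f (i - 1)))\<^sup>2)"
      unfolding norm_ell2_square
      by (rule infsum_mono[OF ell2_norm_summable sum]) (simp add: coord_shift assms(2))
    also have "\<dots> = c * (norm f)\<^sup>2"
      using infsum_reindex_bij_betw[OF reindex, of "\<lambda>i. (norm (coord f i))\<^sup>2"]
      by (simp add: infsum_cmult_right' norm_ell2_square)
    also have "\<dots> = (sqrt c * norm f)\<^sup>2" using assms(1) by (simp add: power_mult_distrib)
    finally show "norm (S *\<^sub>V f) \<le> sqrt c * norm f"
      by (rule power2_le_imp_le) (simp add: assms(1))
  qed (simp add: assms(1))
  then have "(norm S)\<^sup>2 \<le> (sqrt c)\<^sup>2" by (rule power_mono) simp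
  then show ?thesis using assms(1) by simp
qed

text \<open>With \<open>y = Q n h\<close> the quotient is
  \<open>(norm (W (n + 1) y) / norm y)^2\<close>, and \<open>y\<close> runs through all nonzero
  vectors as \<open>h\<close> does. The two inequalities are then \<open>norm_weight_apply\<close>
  and \<open>norm_shift_le\<close>.\<close>

lemma norm_shift_eq_Sup:
  "ennreal ((norm S)\<^sup>2) =
    Sup {ennreal (Re (cinner (gram (n + 1) *\<^sub>V h) h / cinner (gram n *\<^sub>V h) h)) | n h. h \<noteq> 0}"
    (is "_ = Sup ?R")
proof (rule antisym)
  have ratio: "Re (cinner (gram (n + 1) *\<^sub>V h) h / cinner (gram n *\<^sub>V h) h)
      = (norm (W (n + 1) *\<^sub>V Q n *\<^sub>V h))\<^sup>2 / (norm (Q n *\<^sub>V h))\<^sup>2" for n h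
    using Q_step[of "n + 1"]
    by (simp only: cinner_gram of_real_divide[symmetric] Re_complex_of_real) simp
  show "Sup ?R \<le> ennreal ((norm S)\<^sup>2)"
  proof (rule Sup_least)
    fix r assume "r \<in> ?R"
    then obtain n h where h: "h \<noteq> 0"
      "r = ennreal ((norm (W (n + 1) *\<^sub>V Q n *\<^sub>V h))\<^sup>2 / (norm (Q n *\<^sub>V h))\<^sup>2)"
      unfolding ratio by blast
    have "(norm (W (n + 1) *\<^sub>V Q n *\<^sub>V h))\<^sup>2 \<le> (norm S)\<^sup>2 * (norm (Q n *\<^sub>V h))\<^sup>2"
      unfolding power_mult_distrib[symmetric] by (intro power_mono norm_weight_apply) simp
    moreover have "Q n *\<^sub>V h \<noteq> 0"
      using invertible_bop_apply_eq_0[OF invertible_Q] h(1) by blast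
    ultimately show "r \<le> ennreal ((norm S)\<^sup>2)"
      by (simp add: h(2) pos_divide_le_eq ennreal_leI)
  qed
  show "ennreal ((norm S)\<^sup>2) \<le> Sup ?R"
  \<comment> \<open>A finite supremum \<open>c\<close> serves as the constant in
    \<open>norm_shift_le\<close>. On the trivial space the set is empty and
    \<open>c = 0\<close>.\<close>
  proof (cases "Sup ?R")
    case (real c)
    have "(norm (W i *\<^sub>V y))\<^sup>2 \<le> c * (norm y)\<^sup>2" for i y
    proof (cases "y = 0")
      case False
      \<comment> \<open>The preimage of \<open>y\<close> under \<open>Q (i - 1)\<close>, so that the
        quotient at index \<open>i - 1\<close> tests \<open>W i\<close> on \<open>y\<close>.\<close>
      define h where "h = inverse_bop (Q (i - 1)) *\<^sub>V y"
      have Qh: "Q (i - 1) *\<^sub>V h = y"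
        unfolding h_def bop_apply_mult(2)[symmetric] inverse_bop_inverse[OF invertible_Q] by simp
      then have "h \<noteq> 0" using False by auto
      then have "ennreal (Re (cinner (gram (i - 1 + 1) *\<^sub>V h) h / cinner (gram (i - 1) *\<^sub>V h) h)) \<le> ennreal c"
        unfolding real(2)[symmetric] by (intro Sup_upper) blast
      then have "ennreal ((norm (W i *\<^sub>V y))\<^sup>2 / (norm y)\<^sup>2) \<le> ennreal c"
        using ratio[of "i - 1" h] by (simp add: Qh)
      then show ?thesis
        using False real(1) by (simp add: ennreal_le_iff pos_divide_le_eq)
    qed simp
    then have "(norm S)\<^sup>2 \<le> c" by (rule norm_shift_le[OF real(1)])
    then show ?thesis using real by (simp add: ennreal_leI)
  next
    case top
    show ?thesis unfolding top by (rule top_greatest)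
  qed
qed

end

theorem theorem4p2:
  fixes W :: "int \<Rightarrow> 'a::chilbert_space bop" and S :: "'a ell2 bop" and m :: nat
  assumes "bilateral_weighted_shift W S"
    and "\<And>i. invertible_bop (W i)"
    and "1 \<le> m"
  shows "(m_isometric m S \<longleftrightarrow> (\<exists>p \<in> bop_polys (m - 1). interpolates_weights W p)) \<and>
    (\<forall>p \<in> bop_polys (m - 1). interpolates_weights W p \<longrightarrow>
      ennreal ((norm S)\<^sup>2) =
        Sup {ennreal (Re (cinner (p (of_int (n + 1)) *\<^sub>V h) h / cinner (p (of_int n) *\<^sub>V h) h))
          | (n::int) h. h \<noteq> 0})"
proof -
  interpret invertible_shift W S by unfold_locales (rule assms)+
  show ?thesis
  proof (intro conjI ballI impI)
    show "m_isometric m S \<longleftrightarrow> (\<exists>p \<in> bop_polys (m - 1). interpolates_weights W p)"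
      using m_isometric_iff ex_interpolating_poly_iff[OF assms(3)] by simp
  next
    fix p assume "interpolates_weights W p"
    \<comment> \<open>The norm formula involves \<open>p\<close> only at integers, where it agrees
      with \<open>gram\<close>.\<close>
    then have "p (of_int n) = gram n" for n by (simp add: interpolates_weights_iff)
    then show "ennreal ((norm S)\<^sup>2) =
        Sup {ennreal (Re (cinner (p (of_int (n + 1)) *\<^sub>V h) h / cinner (p (of_int n) *\<^sub>V h) h))
          | (n::int) h. h \<noteq> 0}"
      using norm_shift_eq_Sup by (simp only:)
  qed
qed

end
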